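(* Let $d\ge1$, $0<q<2$, $K(z)=-|z|^q$ on $\mathbb R^d$. Assume one of the following: (i) $d+q-2>0$ and $p_c<p\le\infty$, where $p_c:=d/(d+q-2)$; (ii) $d=q=1$ and $p=\infty$; (iii) $d=1$, $0<q<1$, and $1/q<p\le\infty$. Let $\mu\in\mathcal P_{\max\{1,q\}}(\mathbb R^d)\cap L^p(\mathbb R^d)$ be a probability density. For each $N\ge2$, let $X_N^t=(x_i^t)_{i\in[N]}$ be any global collision-free $C^1$ solution of $$\dot x_i^t=-\frac1N\sum_{j\in[N]\setminus\{i\}}\nabla K(x_i^t-x_j^t)+\nabla K*\mu(x_i^t),\qquad i\in[N],$$ with pairwise distinct initial configuration $X_N^0$, and let $\rho_t^N:=\frac1N\sum_{i=1}^N\delta_{x_i^t}$. If $$\mathcal E_N(X_N^0)\longrightarrow0\qquad\text{as }N\to\infty,$$ then $$\sup_{t\ge0}\mathrm{MMD}_q^2(\rho_t^N,\mu)\longrightarrow0.$$ Consequently, for every sequence $t_N\ge0$, $$\rho_{t_N}^N\rightharpoonup\mu\qquad\text{narrowly as }N\to\infty.$$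
   Context: $[N]=\{1,\dots,N\}$; a collision-free solution has pairwise distinct components at all times. $\mathcal P_s(\mathbb R^d)$: Borel probability measures with finite $s$-th moment; densities are identified with measures. $\nabla K(z)=-q|z|^{q-2}z$ for $z\ne0$ and $\nabla K*\mu(x)=\int\nabla K(x-y)\,\mathrm d\mu(y)$. $\mathrm{MMD}_q^2(\rho,\mu):=\frac12\iint(|x|^q+|y|^q-|x-y|^q)\,\mathrm d(\rho-\mu)(x)\,\mathrm d(\rho-\mu)(y)$. The particle energy of $X_N=(x_i)_{i\in[N]}$, with $\rho^N:=\frac1N\sum_i\delta_{x_i}$, is $\mathcal E_N(X_N):=\frac12\iint K(x-y)\,\mathrm d(\rho^N-\mu)(x)\,\mathrm d(\rho^N-\mu)(y)=\mathrm{MMD}_q^2(\rho^N,\mu)$. *)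

theory Defs
  imports "HOL-Probability.Probability"
begin

definition kernel :: "real \<Rightarrow> 'a::euclidean_space \<Rightarrow> real" where
  "kernel q z = - (norm z powr q)"

text \<open>At the origin this gives the value \<open>0\<close>. The convention is immaterial: the particle sum
  omits the diagonal, and the measure \<open>\<mu>\<close> convolved with the gradient has a density.\<close>

definition grad_kernel :: "real \<Rightarrow> 'a::euclidean_space \<Rightarrow> 'a" where
  "grad_kernel q z = - (q * norm z powr (q - 2)) *\<^sub>R z"

definition grad_conv :: "real \<Rightarrow> 'a::euclidean_space measure \<Rightarrow> 'a \<Rightarrow> 'a" where
  "grad_conv q \<mu> x = (LINT y|\<mu>. grad_kernel q (x - y))"

definition prob_moment :: "real \<Rightarrow> 'a::euclidean_space measure set" where
  "prob_moment s = {\<mu>. sets \<mu> = sets borel \<and> prob_space \<mu> \<and> integrable \<mu> (\<lambda>x. norm x powr s)}"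

text \<open>Membership in \<open>L\<^sup>p\<close> with respect to Lebesgue measure, for \<open>1 \<le> p \<le> \<infinity>\<close>.\<close>

definition mem_Lp :: "ereal \<Rightarrow> ('a::euclidean_space \<Rightarrow> real) \<Rightarrow> bool" where
  "mem_Lp p f \<longleftrightarrow> f \<in> borel_measurable lborel \<and>
     (if p = \<infinity> then \<exists>C. AE x in lborel. \<bar>f x\<bar> \<le> C
      else integrable lborel (\<lambda>x. \<bar>f x\<bar> powr real_of_ereal p))"

text \<open>Densities are identified with measures: a measure belongs to \<open>L\<^sup>p\<close> if it has a
  Lebesgue density belonging to \<open>L\<^sup>p\<close>.\<close>

definition measure_in_Lp :: "ereal \<Rightarrow> 'a::euclidean_space measure \<Rightarrow> bool" where
  "measure_in_Lp p \<mu> \<longleftrightarrow>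
     (\<exists>f. (\<forall>x. 0 \<le> f x) \<and> mem_Lp p f \<and> \<mu> = density lborel (\<lambda>x. ennreal (f x)))"

text \<open>Integration against the signed measure \<open>\<rho> - \<mu>\<close>, written out as a difference since the
  library type of measures is nonnegative.\<close>

definition diff_integral :: "'a measure \<Rightarrow> 'a measure \<Rightarrow> ('a \<Rightarrow> real) \<Rightarrow> real" where
  "diff_integral \<rho> \<mu> f = (LINT x|\<rho>. f x) - (LINT x|\<mu>. f x)"

definition MMD2 :: "real \<Rightarrow> 'a::euclidean_space measure \<Rightarrow> 'a measure \<Rightarrow> real" where
  "MMD2 q \<rho> \<mu> = 1 / 2 * diff_integral \<rho> \<mu> (\<lambda>y. diff_integral \<rho> \<mu>
     (\<lambda>x. norm x powr q + norm y powr q - norm (x - y) powr q))"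

text \<open>Only the components \<open>x 1, \<dots>, x N\<close> of a configuration are relevant. The push-forward
  below is the average of the Dirac measures at these points.\<close>

definition empirical :: "nat \<Rightarrow> (nat \<Rightarrow> 'a::euclidean_space) \<Rightarrow> 'a measure" where
  "empirical N x = distr (uniform_count_measure {1..N}) borel x"

lemma emeasure_empirical:
  assumes "A \<in> sets borel"
  shows "emeasure (empirical N x) A = (\<Sum>i\<in>{1..N}. emeasure (return borel (x i)) A) / of_nat N"
proof (cases "N = 0")
  case True
  then show ?thesis
    by (simp add: empirical_def uniform_count_measure_def emeasure_distr assms
      emeasure_point_measure_finite space_point_measure)
next
  case False
  have m: "x \<in> measurable (uniform_count_measure {1..N}) borel"
    by (simp add: uniform_count_measure_def)
  have "(\<Sum>i\<in>{1..N}. emeasure (return borel (x i)) A) = of_nat (card (x -` A \<inter> {1..N}))"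
    using assms by (simp add: sum.If_cases indicator_def Int_def conj_commute)
  moreover have "emeasure (empirical N x) A = of_nat (card (x -` A \<inter> {1..N})) / of_nat N"
    using assms m False unfolding empirical_def
    by (subst emeasure_distr) (auto simp: space_uniform_count_measure emeasure_uniform_count_measure
      divide_ennreal ennreal_of_nat_eq_real_of_nat)
  ultimately show ?thesis by simp
qed

definition particle_energy ::
  "real \<Rightarrow> 'a::euclidean_space measure \<Rightarrow> nat \<Rightarrow> (nat \<Rightarrow> 'a) \<Rightarrow> real" where
  "particle_energy q \<mu> N x = 1 / 2 * diff_integral (empirical N x) \<mu> (\<lambda>w.
     diff_integral (empirical N x) \<mu> (\<lambda>z. kernel q (z - w)))"

definition velocity ::
  "real \<Rightarrow> 'a::euclidean_space measure \<Rightarrow> nat \<Rightarrow> (nat \<Rightarrow> 'a) \<Rightarrow> nat \<Rightarrow> 'a" where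
  "velocity q \<mu> N x i =
     - ((1 / real N) *\<^sub>R (\<Sum>j\<in>{1..N} - {i}. grad_kernel q (x i - x j))) + grad_conv q \<mu> (x i)"

text \<open>The trajectory of particle \<open>i\<close> is \<open>X i\<close>; at time \<open>0\<close> the derivative is one-sided.
  The last conjunct says that the derivative is continuous, so that trajectories are \<open>C\<^sup>1\<close>.\<close>

definition collision_free_solution ::
  "real \<Rightarrow> 'a::euclidean_space measure \<Rightarrow> nat \<Rightarrow> (nat \<Rightarrow> real \<Rightarrow> 'a) \<Rightarrow> bool" where
  "collision_free_solution q \<mu> N X \<longleftrightarrow>
     (\<forall>t\<ge>0. inj_on (\<lambda>i. X i t) {1..N}) \<and>
     (\<forall>i\<in>{1..N}.
        (\<forall>t\<ge>0. (X i has_vector_derivative velocity q \<mu> N (\<lambda>j. X j t) i) (at t within {0..})) \<and>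
        continuous_on {0..} (\<lambda>t. velocity q \<mu> N (\<lambda>j. X j t) i))"

definition narrowly_converges ::
  "(nat \<Rightarrow> 'a::euclidean_space measure) \<Rightarrow> 'a measure \<Rightarrow> bool" where
  "narrowly_converges \<rho> \<mu> \<longleftrightarrow>
     (\<forall>f :: 'a \<Rightarrow> real. continuous_on UNIV f \<and> bounded (range f) \<longrightarrow>
        (\<lambda>N. LINT x|\<rho> N. f x) \<longlonglongrightarrow> (LINT x|\<mu>. f x))"

end

theory Submission
  imports Defs
begin

text \<open>
The particle system is a gradient flow: the velocities are \<open>- N\<close> times the gradient of the particle
energy, which equals the squared discrepancy \<open>MMD2\<close> between the empirical measure and \<open>\<mu>\<close>. Hence
the discrepancy does not increase in time (\<open>MMD2_antimono\<close>), its supremum over all times is the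
initial energy, and the first claim follows.

The only difficulty in this part is that the potential \<open>x \<mapsto> \<integral>|x - y|\<^sup>q d\<mu>(y)\<close> has to be
differentiable at every point (\<open>has_derivative_potential\<close>). For \<open>q < 1\<close> this needs the integrals of
\<open>|x - y| powr (q - 1)\<close> to be finite, and this is what the lower bound on \<open>p\<close> provides
(\<open>integrable_singular_kernel\<close>).

For the second claim it remains to see that a vanishing discrepancy forces narrow convergence. By
Schoenberg's formula, \<open>|z|\<^sup>q\<close> is a mixture over \<open>s > 0\<close> of the functions \<open>1 - exp (- s |z|\<^sup>2)\<close>, so
the discrepancy is a mixture of the quadratic forms of Gaussian kernels at \<open>\<rho> - \<mu>\<close>
(\<open>MMD2_gaussian_mixture\<close>). Each of these forms is a multiple of the squared \<open>L\<^sup>2\<close> norm of a Gaussian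
smoothing of \<open>\<rho> - \<mu>\<close> (\<open>smooth_difference_L2\<close>); in particular it is nonnegative. A small
discrepancy therefore makes the form small at some scale \<open>s\<close> in any prescribed interval
\<open>[a, 2 a]\<close>, and Cauchy--Schwarz then controls the integrals against \<open>\<rho> - \<mu>\<close> of test functions
smoothed at this scale. For large \<open>a\<close> the smoothing hardly changes a uniformly continuous function,
which gives convergence for test functions with compact support (\<open>test_function_bound\<close>). As the
limit \<open>\<mu>\<close> is a probability measure, no mass is lost at infinity, and the convergence extends to all
bounded continuous functions (\<open>narrowly_converges_if_MMD2_tendsto_0\<close>).
\<close>

section \<open>Elementary inequalities for powers\<close>

text \<open>One Lipschitz-type bound for all exponents up to \<open>2\<close>, so that the cases \<open>q < 1\<close> and \<open>q > 1\<close>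
need not be separated: after scaling the larger number to \<open>1\<close> and the smaller one to
\<open>r \<in> [0, 1]\<close>, it says \<open>1 - r\<^sup>q \<le> 2 (1 - r)\<close>, which holds since \<open>1 - r\<^sup>q \<le> 1 - r\<^sup>2\<close>.\<close>

lemma powr_diff_le:
  fixes a b q :: real
  assumes "0 \<le> a" "0 \<le> b" "0 < q" "q \<le> 2"
  shows "\<bar>a powr q - b powr q\<bar> \<le> 2 * max a b powr (q - 1) * \<bar>a - b\<bar>"
proof -
  have *: "\<bar>a powr q - b powr q\<bar> \<le> 2 * a powr (q - 1) * \<bar>a - b\<bar>"
    if "0 \<le> b" "b \<le> a" for a b :: real
  proof (cases "a = 0")
    case True
    then show ?thesis using that by simp
  next
    case False
    with that have a: "a > 0" by simp
    define r where "r = b / a"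
    have r: "0 \<le> r" "r \<le> 1" and b: "b = a * r"
      using that a by (auto simp: r_def)
    have "1 - r powr q \<le> 1 - r powr 2"
      using r assms powr_mono'[of q 2 r] by (cases "r = 0") auto
    also have "r powr 2 = r ^ 2"
      using r by simp
    also have "1 - r ^ 2 \<le> 2 * (1 - r)"
      using sum_squares_ge_zero[of "1 - r" 0] by (simp add: power2_eq_square algebra_simps)
    finally have "a powr q * (1 - r powr q) \<le> a powr q * (2 * (1 - r))"
      by (intro mult_left_mono) auto
    moreover have "b powr q \<le> a powr q"
      using that assms by (intro powr_mono2) auto
    moreover have "a powr q = a powr (q - 1) * a"
      using a by (simp add: powr_diff)
    ultimately show ?thesis
      using that by (simp add: b powr_mult algebra_simps)
  qed
  show ?thesis
    using *[of a b] *[of b a] assms by (cases "b \<le> a") (auto simp: max_def abs_minus_commute)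
qed

lemma powr_add_one_le:
  fixes a r :: real
  assumes "0 \<le> a" "r \<le> 1"
  shows "(a + 1) powr r \<le> a powr r + 1"
proof (cases "a = 0")
  case False
  with assms have a: "a > 0" by simp
  have "(a + 1) powr r = (a + 1) * (a + 1) powr (r - 1)"
    using a by (simp add: powr_diff)
  also have "\<dots> = a * (a + 1) powr (r - 1) + (a + 1) powr (r - 1)"
    by (simp add: algebra_simps)
  also have "\<dots> \<le> a * a powr (r - 1) + 1"
  proof (intro add_mono mult_left_mono)
    show "(a + 1) powr (r - 1) \<le> a powr (r - 1)"
      using a assms by (intro powr_mono2') auto
    have "(a + 1) powr (r - 1) \<le> 1 powr (r - 1)"
      using a assms by (intro powr_mono2') auto
    then show "(a + 1) powr (r - 1) \<le> 1" by simp
  qed (use a in auto)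
  also have "a * a powr (r - 1) = a powr r"
    using a by (simp add: powr_diff)
  finally show ?thesis .
qed auto

text \<open>The factor on the right depends on \<open>a\<close> only. Applied to \<open>a = |x - y|\<close> and \<open>b = |x + h - y|\<close>, it
bounds the difference quotients of \<open>|x - y|\<^sup>q\<close> uniformly over increments \<open>h\<close> of norm at most \<open>1\<close>,
even though for \<open>q < 1\<close> the derivative is unbounded near \<open>y = x + h\<close>. For \<open>q \<le> 1\<close> this works because the power
\<open>q - 1\<close> is decreasing, so that the larger of \<open>a\<close> and \<open>b\<close> gives the smaller factor.\<close>

lemma powr_increment_le:
  fixes a b q :: real
  assumes "0 < a" "0 \<le> b" "0 < q" "q \<le> 2" "\<bar>a - b\<bar> \<le> 1"
  shows "\<bar>b powr q - a powr q\<bar> \<le> 2 * (a powr (q - 1) + 1) * \<bar>b - a\<bar>"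
proof -
  have "max a b powr (q - 1) \<le> a powr (q - 1) + 1"
  proof (cases "q \<le> 1")
    case True
    then have "max a b powr (q - 1) \<le> a powr (q - 1)"
      using assms by (intro powr_mono2') auto
    then show ?thesis by simp
  next
    case False
    then have "max a b powr (q - 1) \<le> (a + 1) powr (q - 1)"
      using assms by (intro powr_mono2) auto
    also have "\<dots> \<le> a powr (q - 1) + 1"
      using assms by (intro powr_add_one_le) auto
    finally show ?thesis .
  qed
  then have "2 * max a b powr (q - 1) * \<bar>b - a\<bar> \<le> 2 * (a powr (q - 1) + 1) * \<bar>b - a\<bar>"
    by (intro mult_right_mono) auto
  moreover have "\<bar>a powr q - b powr q\<bar> \<le> 2 * max a b powr (q - 1) * \<bar>a - b\<bar>"
    using assms by (intro powr_diff_le) auto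
  ultimately show ?thesis by (simp add: abs_minus_commute)
qed

lemma norm_diff_powr_le:
  fixes x y :: "'a::real_normed_vector"
  assumes "0 < q"
  shows "norm (x - y) powr q \<le> 2 powr q * (norm x powr q + norm y powr q)"
proof -
  have "norm (x - y) \<le> 2 * max (norm x) (norm y)"
    using norm_triangle_ineq4[of x y] by simp
  then have "norm (x - y) powr q \<le> (2 * max (norm x) (norm y)) powr q"
    using assms by (intro powr_mono2) auto
  also have "\<dots> = 2 powr q * max (norm x) (norm y) powr q"
    by (simp add: powr_mult)
  also have "max (norm x) (norm y) powr q \<le> norm x powr q + norm y powr q"
    by (simp add: max_def)
  finally show ?thesis by simp
qed

section \<open>Singular and Gaussian integrals\<close>

text \<open>On the dyadic shell of radius about \<open>2\<^sup>-\<^sup>k\<close> the integrand is at most a constant times \<open>2\<^sup>a\<^sup>k\<close>, and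
the shell has volume at most a constant times \<open>2\<^sup>-\<^sup>d\<^sup>k\<close>, where \<open>d\<close> is the dimension. As \<open>a < d\<close>,
the sum is a convergent geometric series.\<close>

lemma nn_integral_norm_powr_unit_ball:
  assumes a: "0 \<le> a" "a < real DIM('a::euclidean_space)"
  shows "(\<integral>\<^sup>+z. ennreal (norm z powr - a) * indicator (ball 0 1) z \<partial>(lborel :: 'a measure)) < \<infinity>"
proof -
  define d where "d = real DIM('a)"
  define V where "V = unit_ball_vol d"
  have V: "V \<ge> 0" by (simp add: V_def d_def)
  \<comment> \<open>The largest value of the integrand on the shell \<open>2 powr - (k + 1) \<le> norm z < 2 powr - k\<close>.\<close>
  define c :: "nat \<Rightarrow> real" where "c k = 2 powr (a * real (Suc k))" for k
  have "(\<integral>\<^sup>+z. ennreal (norm z powr - a) * indicator (ball 0 1) z \<partial>(lborel :: 'a measure)) \<le>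
    (\<integral>\<^sup>+z. (\<Sum>k. ennreal (c k) * indicator (ball 0 (2 powr - real k)) z) \<partial>(lborel :: 'a measure))"
  proof (intro nn_integral_mono)
    fix z :: 'a
    show "ennreal (norm z powr - a) * indicator (ball 0 1) z \<le>
      (\<Sum>k. ennreal (c k) * indicator (ball 0 (2 powr - real k)) z)"
    proof (cases "z \<in> ball 0 1 \<and> z \<noteq> 0")
      case True
      then have z: "0 < norm z" "norm z < 1" by auto
      define l where "l = - log 2 (norm z)"
      have l: "l > 0" using z by (simp add: l_def)
      define k where "k = nat (\<lceil>l\<rceil> - 1)"
      have k: "real k < l" "l \<le> real (Suc k)"
        using l unfolding k_def by linarith+
      have nz: "norm z = 2 powr - l" using z by (simp add: l_def)
      have "ennreal (norm z powr - a) \<le> ennreal (c k)"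
        unfolding c_def nz powr_powr using k a by (intro ennreal_leI powr_mono) (auto intro: mult_left_mono simp: mult.commute)
      also have "\<dots> = ennreal (c k) * indicator (ball 0 (2 powr - real k)) z"
        using k by (simp add: nz)
      also have "\<dots> \<le> (\<Sum>k. ennreal (c k) * indicator (ball 0 (2 powr - real k)) z)"
        using sum_le_suminf[of "\<lambda>k. ennreal (c k) * indicator (ball 0 (2 powr - real k)) z" "{k}"]
        by (simp del: sum_mult_indicator)
      finally show ?thesis using True by simp
    qed auto
  qed
  also have "\<dots> = (\<Sum>k. \<integral>\<^sup>+z. ennreal (c k) * indicator (ball 0 (2 powr - real k)) z \<partial>(lborel :: 'a measure))"
    by (intro nn_integral_suminf borel_measurable_times_ennreal borel_measurable_indicator) auto
  also have "\<dots> = (\<Sum>k. ennreal (V * 2 powr a * (2 powr (a - d)) ^ k))"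
  proof (intro suminf_cong)
    fix k
    have "(\<integral>\<^sup>+z. ennreal (c k) * indicator (ball 0 (2 powr - real k)) z \<partial>(lborel :: 'a measure)) =
      ennreal (c k) * emeasure lborel (ball (0::'a) (2 powr - real k))"
      by (simp add: nn_integral_cmult_indicator)
    also have "\<dots> = ennreal (c k) * ennreal (V * (2 powr - real k) ^ DIM('a))"
      by (subst emeasure_ball) (auto simp: V_def d_def)
    also have "\<dots> = ennreal (c k * (V * (2 powr - real k) ^ DIM('a)))"
      using V by (subst ennreal_mult) (auto simp: c_def)
    also have "c k * (V * (2 powr - real k) ^ DIM('a)) = V * (2 powr a * (2 powr (a - d)) ^ k)"
      unfolding c_def d_def
      by (simp add: powr_realpow[symmetric] powr_powr powr_add[symmetric] algebra_simps)
    finally show "(\<integral>\<^sup>+z. ennreal (c k) * indicator (ball 0 (2 powr - real k)) z \<partial>(lborel :: 'a measure)) =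
      ennreal (V * 2 powr a * (2 powr (a - d)) ^ k)" by (simp add: mult.assoc)
  qed
  also have "\<dots> < \<infinity>"
  proof -
    have "2 powr (a - d) < (2::real) powr 0"
      using a by (intro powr_less_mono) (auto simp: d_def)
    then have "summable (\<lambda>k. V * 2 powr a * (2 powr (a - d)) ^ k)"
      by (intro summable_mult summable_geometric) auto
    then show ?thesis
      using V by (subst suminf_ennreal2) auto
  qed
  finally show ?thesis .
qed

text \<open>The Gaussian is a product of one-dimensional Gaussians, and each of these is a multiple of a normal
density.\<close>

lemma nn_integral_gaussian:
  assumes c: "0 < c"
  shows "(\<integral>\<^sup>+z. ennreal (exp (- c * (norm z)\<^sup>2)) \<partial>(lborel :: 'a::euclidean_space measure)) < \<infinity>"
proof -
  define s where "s = 1 / sqrt (2 * c)"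
  have s: "s > 0" "s\<^sup>2 = 1 / (2 * c)" using c by (auto simp: s_def power_divide)
  have "integrable lborel (\<lambda>x::real. sqrt (2 * pi * s\<^sup>2) * normal_density 0 s x)"
    using s by (intro integrable_mult_right integrable_normal_density) auto
  moreover have "(\<lambda>x::real. sqrt (2 * pi * s\<^sup>2) * normal_density 0 s x) = (\<lambda>x. exp (- c * x\<^sup>2))"
    using c s by (auto simp: normal_density_def)
  ultimately have "integrable lborel (\<lambda>x::real. exp (- c * x\<^sup>2))" by simp
  then have 1: "(\<integral>\<^sup>+x. ennreal (exp (- c * x\<^sup>2)) \<partial>(lborel :: real measure)) < \<infinity>"
    by (simp add: integrable_iff_bounded)
  interpret product_sigma_finite "\<lambda>b::'a. lborel :: real measure" by standard
  have "(\<integral>\<^sup>+z. ennreal (exp (- c * (norm z)\<^sup>2)) \<partial>(lborel :: 'a measure)) =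
    (\<integral>\<^sup>+f. ennreal (exp (- c * (norm (\<Sum>b\<in>Basis. f b *\<^sub>R b :: 'a))\<^sup>2)) \<partial>(\<Pi>\<^sub>M b\<in>(Basis :: 'a set). lborel))"
    by (subst lborel_eq, subst nn_integral_distr) auto
  also have "\<dots> = (\<integral>\<^sup>+f. (\<Prod>b\<in>(Basis :: 'a set). ennreal (exp (- c * (f b)\<^sup>2))) \<partial>(\<Pi>\<^sub>M b\<in>(Basis :: 'a set). lborel))"
  proof (intro nn_integral_cong)
    fix f :: "'a \<Rightarrow> real"
    have "(norm (\<Sum>b\<in>Basis. f b *\<^sub>R b :: 'a))\<^sup>2 = (\<Sum>b\<in>(Basis :: 'a set). (f b)\<^sup>2)"
      unfolding power2_norm_eq_inner
      by (subst euclidean_inner) (simp add: inner_sum_left_Basis power2_eq_square)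
    then show "ennreal (exp (- c * (norm (\<Sum>b\<in>Basis. f b *\<^sub>R b :: 'a))\<^sup>2)) =
      (\<Prod>b\<in>(Basis :: 'a set). ennreal (exp (- c * (f b)\<^sup>2)))"
      by (simp add: sum_distrib_left exp_sum prod_ennreal sum_negf[symmetric])
  qed
  also have "\<dots> = (\<Prod>b\<in>(Basis :: 'a set). \<integral>\<^sup>+x. ennreal (exp (- c * x\<^sup>2)) \<partial>(lborel :: real measure))"
    by (subst product_nn_integral_prod) auto
  also have "\<dots> < \<infinity>"
    using 1 by (simp add: power_less_top_ennreal)
  finally show ?thesis .
qed

section \<open>The discrepancy in terms of mutual energies\<close>

text \<open>The potential is built from \<open>|z|\<^sup>q\<close>, which is minus the interaction kernel; its gradient is
therefore \<open>- grad_conv\<close>.\<close>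

definition potential :: "real \<Rightarrow> 'a::euclidean_space measure \<Rightarrow> 'a \<Rightarrow> real" where
  "potential q \<mu> x = (LINT y|\<mu>. norm (x - y) powr q)"

definition mutual_energy :: "real \<Rightarrow> 'a::euclidean_space measure \<Rightarrow> 'a measure \<Rightarrow> real" where
  "mutual_energy q \<alpha> \<beta> = (LINT x|\<alpha>. potential q \<beta> x)"

lemma prob_momentD:
  assumes "\<mu> \<in> prob_moment s"
  shows "sets \<mu> = sets borel" "prob_space \<mu>" "integrable \<mu> (\<lambda>x. norm x powr s)"
  using assms by (auto simp: prob_moment_def)

lemma prob_moment_mono:
  assumes "\<mu> \<in> prob_moment s" "0 < q" "q \<le> s"
  shows "\<mu> \<in> prob_moment q"
proof -
  note \<mu> = prob_momentD[OF assms(1)]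
  note [measurable_cong] = \<mu>(1)
  interpret prob_space \<mu> by fact
  have *: "u powr q \<le> 1 + u powr s" if "0 \<le> u" for u :: real
  proof (cases "u \<le> 1")
    case True
    then have "u powr q \<le> 1 powr q" using that assms by (intro powr_mono2) auto
    then show ?thesis by (simp add: add_increasing2)
  next
    case False
    then have "u powr q \<le> u powr s" using assms by (intro powr_mono) auto
    then show ?thesis by simp
  qed
  have "integrable \<mu> (\<lambda>x. norm x powr q)"
  proof (rule Bochner_Integration.integrable_bound)
    show "integrable \<mu> (\<lambda>x. 1 + norm x powr s)" using \<mu> by simp
    show "AE x in \<mu>. norm (norm x powr q) \<le> norm (1 + norm x powr s)"
      using * by (auto intro!: AE_I2 order_trans[OF _ abs_ge_self])
  qed measurable
  then show ?thesis using \<mu> by (simp add: prob_moment_def)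
qed

lemma integrable_potential_kernel:
  fixes x :: "'a::euclidean_space"
  assumes "\<mu> \<in> prob_moment q" "0 < q"
  shows "integrable \<mu> (\<lambda>y. norm (x - y) powr q)"
proof -
  note \<mu> = prob_momentD[OF assms(1)]
  note [measurable_cong] = \<mu>(1)
  interpret prob_space \<mu> by fact
  show ?thesis
  proof (rule Bochner_Integration.integrable_bound)
    show "integrable \<mu> (\<lambda>y. 2 powr q * (norm x powr q + norm y powr q))" using \<mu> by simp
    show "AE y in \<mu>. norm (norm (x - y) powr q) \<le> norm (2 powr q * (norm x powr q + norm y powr q))"
      using norm_diff_powr_le[OF assms(2)] by (auto intro!: AE_I2)
  qed measurable
qed

lemma integrable_pair_norm_powr:
  fixes \<alpha> \<beta> :: "'a::euclidean_space measure"
  assumes \<alpha>: "\<alpha> \<in> prob_moment q" and \<beta>: "\<beta> \<in> prob_moment q" and "0 < q"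
  shows "integrable (\<alpha> \<Otimes>\<^sub>M \<beta>) (\<lambda>(x, y). norm (x - y) powr q)"
proof -
  note a = prob_momentD[OF \<alpha>] and b = prob_momentD[OF \<beta>]
  note [measurable_cong] = a(1) b(1)
  interpret a: prob_space \<alpha> by fact
  interpret b: prob_space \<beta> by fact
  interpret pair_prob_space \<alpha> \<beta> ..
  have "integrable (\<alpha> \<Otimes>\<^sub>M \<beta>) (\<lambda>(x, y). norm x powr q + norm y powr q)"
    using a b by (intro Fubini_integrable) (auto simp: split_def)
  then have i: "integrable (\<alpha> \<Otimes>\<^sub>M \<beta>) (\<lambda>(x, y). 2 powr q * (norm x powr q + norm y powr q))"
    by (auto simp: split_def)
  show ?thesis
  proof (rule Bochner_Integration.integrable_bound[OF i])
    show "AE p in \<alpha> \<Otimes>\<^sub>M \<beta>. norm (case p of (x, y) \<Rightarrow> norm (x - y) powr q) \<le>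
       norm (case p of (x, y) \<Rightarrow> 2 powr q * (norm x powr q + norm y powr q))"
      using norm_diff_powr_le[OF assms(3)] by (auto intro!: AE_I2)
  qed measurable
qed

lemma integrable_potential:
  fixes \<alpha> \<beta> :: "'a::euclidean_space measure"
  assumes \<alpha>: "\<alpha> \<in> prob_moment q" and \<beta>: "\<beta> \<in> prob_moment q" and "0 < q"
  shows "integrable \<alpha> (potential q \<beta>)"
proof -
  interpret a: prob_space \<alpha> using prob_momentD[OF \<alpha>] by simp
  interpret b: prob_space \<beta> using prob_momentD[OF \<beta>] by simp
  interpret pair_prob_space \<alpha> \<beta> ..
  show ?thesis
    using integrable_fst'[OF integrable_pair_norm_powr[OF assms]]
    by (simp add: potential_def[abs_def])
qed

lemma mutual_energy_commute:
  fixes \<alpha> \<beta> :: "'a::euclidean_space measure"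
  assumes \<alpha>: "\<alpha> \<in> prob_moment q" and \<beta>: "\<beta> \<in> prob_moment q" and "0 < q"
  shows "mutual_energy q \<alpha> \<beta> = mutual_energy q \<beta> \<alpha>"
proof -
  interpret a: prob_space \<alpha> using prob_momentD[OF \<alpha>] by simp
  interpret b: prob_space \<beta> using prob_momentD[OF \<beta>] by simp
  interpret pair_prob_space \<alpha> \<beta> ..
  show ?thesis
    using Fubini_integral[OF integrable_pair_norm_powr[OF assms]]
    by (simp add: potential_def[abs_def] mutual_energy_def norm_minus_commute)
qed

lemma potential_commute: "(LINT y|\<mu>. norm (y - x) powr q) = potential q \<mu> x"
  by (simp add: potential_def norm_minus_commute)

text \<open>The common core of the discrepancy and of the particle energy. The inner integral against
\<open>\<rho> - \<mu>\<close> leaves \<open>c\<close> minus a difference of potentials, with \<open>c\<close> collecting what does not depend on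
the outer variable; since \<open>\<rho> - \<mu>\<close> has total mass zero, \<open>c\<close> disappears in the outer integral.\<close>

lemma diff_integral_potential:
  fixes \<rho> \<mu> :: "'a::euclidean_space measure"
  assumes \<rho>: "\<rho> \<in> prob_moment q" and \<mu>: "\<mu> \<in> prob_moment q" and q: "0 < q"
  shows "diff_integral \<rho> \<mu> (\<lambda>y. c - (potential q \<rho> y - potential q \<mu> y)) =
    2 * mutual_energy q \<rho> \<mu> - mutual_energy q \<rho> \<rho> - mutual_energy q \<mu> \<mu>"
proof -
  interpret a: prob_space \<rho> using prob_momentD[OF \<rho>] by simp
  interpret b: prob_space \<mu> using prob_momentD[OF \<mu>] by simp
  note [simp] = integrable_potential[OF \<rho> \<rho> q] integrable_potential[OF \<rho> \<mu> q]
    integrable_potential[OF \<mu> \<rho> q] integrable_potential[OF \<mu> \<mu> q]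
  show ?thesis
    using mutual_energy_commute[OF \<mu> \<rho> q]
    by (simp add: diff_integral_def mutual_energy_def a.prob_space b.prob_space)
qed

lemma MMD2_eq_mutual_energy:
  fixes \<rho> \<mu> :: "'a::euclidean_space measure"
  assumes \<rho>: "\<rho> \<in> prob_moment q" and \<mu>: "\<mu> \<in> prob_moment q" and q: "0 < q"
  shows "MMD2 q \<rho> \<mu> = mutual_energy q \<rho> \<mu> - mutual_energy q \<rho> \<rho> / 2 - mutual_energy q \<mu> \<mu> / 2"
proof -
  have *: "(LINT x|\<alpha>. norm x powr q + norm y powr q - norm (x - y) powr q) =
    (LINT x|\<alpha>. norm x powr q) + norm y powr q - potential q \<alpha> y"
    if "\<alpha> \<in> prob_moment q" for \<alpha> and y :: 'a
  proof -
    interpret a: prob_space \<alpha> using prob_momentD[OF that] by simp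
    have "integrable \<alpha> (\<lambda>x. norm (x - y) powr q)"
      using integrable_potential_kernel[OF that q, of y] by (simp add: norm_minus_commute)
    then show ?thesis
      using prob_momentD[OF that] by (simp add: potential_commute a.prob_space)
  qed
  define c where "c = (LINT x|\<rho>. norm x powr q) - (LINT x|\<mu>. norm x powr q)"
  have "diff_integral \<rho> \<mu> (\<lambda>x. norm x powr q + norm y powr q - norm (x - y) powr q) =
      c - (potential q \<rho> y - potential q \<mu> y)" for y
    by (simp add: diff_integral_def *[OF \<rho>] *[OF \<mu>] c_def)
  then have "MMD2 q \<rho> \<mu> = 1 / 2 * diff_integral \<rho> \<mu> (\<lambda>y. c - (potential q \<rho> y - potential q \<mu> y))"
    by (simp only: MMD2_def)
  then show ?thesis
    using diff_integral_potential[OF assms, of c] by simp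
qed

lemma particle_energy_eq_MMD2:
  assumes "empirical N x \<in> prob_moment q" "\<mu> \<in> prob_moment q" "0 < q"
  shows "particle_energy q \<mu> N x = MMD2 q (empirical N x) \<mu>"
proof -
  have "diff_integral (empirical N x) \<mu> (\<lambda>z. kernel q (z - w)) =
    0 - (potential q (empirical N x) w - potential q \<mu> w)" for w
    by (simp add: diff_integral_def kernel_def potential_commute)
  then have "particle_energy q \<mu> N x = 1 / 2 * diff_integral (empirical N x) \<mu>
    (\<lambda>w. 0 - (potential q (empirical N x) w - potential q \<mu> w))"
    by (simp only: particle_energy_def)
  then show ?thesis
    using diff_integral_potential[OF assms, of 0] MMD2_eq_mutual_energy[OF assms]
    by (simp add: field_simps)
qed

lemma sets_empirical [simp, measurable_cong]: "sets (empirical N x) = sets borel"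
  by (simp add: empirical_def)

lemma empirical_measurable: "x \<in> measurable (uniform_count_measure {1..N}) borel"
  by (simp add: uniform_count_measure_def)

lemma integral_empirical:
  fixes f :: "'a::euclidean_space \<Rightarrow> real"
  assumes [measurable]: "f \<in> borel_measurable borel"
  shows "(LINT y|empirical N x. f y) = (\<Sum>i\<in>{1..N}. f (x i)) / real N"
  unfolding empirical_def
  by (subst integral_distr[OF empirical_measurable]) (auto simp: integral_uniform_count_measure)

lemma integrable_empirical:
  fixes f :: "'a::euclidean_space \<Rightarrow> real"
  assumes [measurable]: "f \<in> borel_measurable borel"
  shows "integrable (empirical N x) f"
  unfolding empirical_def uniform_count_measure_def
  by (subst integrable_distr_eq) (auto simp: integrable_point_measure_finite)

lemma empirical_prob_moment:
  assumes "N \<ge> 1"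
  shows "empirical N x \<in> prob_moment q"
proof -
  interpret u: prob_space "uniform_count_measure {1..N}"
    using assms by (intro prob_space_uniform_count_measure) auto
  have "prob_space (empirical N x)"
    unfolding empirical_def by (rule u.prob_space_distr[OF empirical_measurable])
  then show ?thesis
    by (simp add: prob_moment_def integrable_empirical)
qed

lemma borel_measurable_potential:
  assumes "\<mu> \<in> prob_moment q"
  shows "potential q \<mu> \<in> borel_measurable borel"
proof -
  note \<mu> = prob_momentD[OF assms]
  note [measurable_cong] = \<mu>(1)
  interpret prob_space \<mu> by fact
  show ?thesis unfolding potential_def[abs_def] by measurable
qed

text \<open>The diagonal of the interaction sum vanishes. What remains are distances between distinct particles,
which stay in the region where \<open>|z|\<^sup>q\<close> is differentiable as long as there are no collisions.\<close>

lemma MMD2_empirical: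
  fixes x :: "nat \<Rightarrow> 'a::euclidean_space"
  assumes N: "N \<ge> 1" and \<mu>: "\<mu> \<in> prob_moment q" and q: "0 < q"
  shows "MMD2 q (empirical N x) \<mu> =
    (\<Sum>i\<in>{1..N}. potential q \<mu> (x i)) / real N
    - (\<Sum>i\<in>{1..N}. \<Sum>j\<in>{1..N} - {i}. norm (x i - x j) powr q) / (2 * (real N)\<^sup>2)
    - mutual_energy q \<mu> \<mu> / 2"
proof -
  note e = empirical_prob_moment[OF N, of x q]
  have "potential q (empirical N x) y = (\<Sum>j\<in>{1..N}. norm (y - x j) powr q) / real N" for y
    unfolding potential_def by (subst integral_empirical) auto
  then have "mutual_energy q (empirical N x) (empirical N x) =
     (\<Sum>i\<in>{1..N}. \<Sum>j\<in>{1..N}. norm (x i - x j) powr q) / (real N)\<^sup>2"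
    unfolding mutual_energy_def
    by (subst integral_empirical[OF borel_measurable_potential[OF e]])
       (simp add: power2_eq_square sum_divide_distrib)
  also have "(\<Sum>i\<in>{1..N}. \<Sum>j\<in>{1..N}. norm (x i - x j) powr q) =
    (\<Sum>i\<in>{1..N}. \<Sum>j\<in>{1..N} - {i}. norm (x i - x j) powr q)"
    by (intro sum.cong refl sum.mono_neutral_right) auto
  finally show ?thesis
    unfolding MMD2_eq_mutual_energy[OF e \<mu> q]
    by (simp add: mutual_energy_def integral_empirical[OF borel_measurable_potential[OF \<mu>]])
qed

section \<open>Differentiability of the potential\<close>

lemma norm_grad_kernel:
  assumes "0 < q"
  shows "norm (grad_kernel q z) = q * norm z powr (q - 1)"
proof (cases "z = 0")
  case False
  then have "norm z powr (q - 1) = norm z powr (q - 2) * norm z"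
    by (simp add: powr_diff power2_eq_square)
  then show ?thesis using assms by (simp add: grad_kernel_def)
qed (simp add: grad_kernel_def)

lemma has_derivative_norm_powr:
  fixes z :: "'a::euclidean_space"
  assumes z: "z \<noteq> 0"
  shows "((\<lambda>z. norm z powr q) has_derivative (\<lambda>h. - grad_kernel q z \<bullet> h)) (at z)"
proof -
  have "((\<lambda>u. u powr q) has_derivative (\<lambda>h. q * norm z powr (q - 1) * h)) (at (norm z))"
    using has_real_derivative_powr[of "norm z" q] z by (simp add: has_field_derivative_def)
  from has_derivative_compose[OF has_derivative_norm[OF z] this]
  have "((\<lambda>z. norm z powr q) has_derivative (\<lambda>h. q * norm z powr (q - 1) * (sgn z \<bullet> h))) (at z)"
    by (simp add: o_def inner_commute)
  moreover have "q * norm z powr (q - 1) * (sgn z \<bullet> h) = - grad_kernel q z \<bullet> h" for h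
    using z by (simp add: sgn_div_norm grad_kernel_def powr_diff power2_eq_square divide_simps)
  ultimately show ?thesis by simp
qed

lemma borel_measurable_grad_kernel [measurable]: "grad_kernel q \<in> borel_measurable borel"
  unfolding grad_kernel_def[abs_def] by measurable

lemma integrable_grad_kernel:
  fixes \<mu> :: "'a::euclidean_space measure"
  assumes [measurable_cong]: "sets \<mu> = sets borel" and "0 < q"
    and i: "integrable \<mu> (\<lambda>y. norm (x - y) powr (q - 1))"
  shows "integrable \<mu> (\<lambda>y. grad_kernel q (x - y))"
proof (rule Bochner_Integration.integrable_bound)
  show "integrable \<mu> (\<lambda>y. q * norm (x - y) powr (q - 1))" using i by simp
  show "AE y in \<mu>. norm (grad_kernel q (x - y)) \<le> norm (q * norm (x - y) powr (q - 1))"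
    using assms by (simp add: norm_grad_kernel)
qed measurable

text \<open>Differentiation under the integral by dominated convergence along an arbitrary null sequence of
increments. The difference quotient at \<open>y \<noteq> x\<close> is dominated by \<open>2 (|x - y| powr (q - 1) + 1)\<close>
according to \<open>powr_increment_le\<close>, plus the norm of the gradient; this is where the
integrability of \<open>|x - y| powr (q - 1)\<close> enters.\<close>

lemma has_derivative_potential:
  fixes \<mu> :: "'a::euclidean_space measure"
  assumes \<mu>: "\<mu> \<in> prob_moment q" and q: "0 < q" "q < 2"
    and i: "integrable \<mu> (\<lambda>y. norm (x - y) powr (q - 1))"
    and ne: "AE y in \<mu>. y \<noteq> x"
  shows "(potential q \<mu> has_derivative (\<lambda>h. - grad_conv q \<mu> x \<bullet> h)) (at x)"
proof -
  note m = prob_momentD[OF \<mu>]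
  note [measurable_cong] = m(1)
  interpret prob_space \<mu> by fact
  note k = integrable_potential_kernel[OF \<mu> q(1)]
  note g = integrable_grad_kernel[OF m(1) q(1) i]
  \<comment> \<open>The remainder quotient of the integrand at \<open>x\<close> for the increment \<open>h\<close>.\<close>
  define R where "R h y =
    (norm (x + h - y) powr q - norm (x - y) powr q - (- grad_kernel q (x - y)) \<bullet> h) / norm h"
    for h y
  have R_integral: "(LINT y|\<mu>. R h y) =
      (potential q \<mu> (x + h) - potential q \<mu> x - (- grad_conv q \<mu> x) \<bullet> h) / norm h" for h
  proof -
    have "integrable \<mu> (\<lambda>y. grad_kernel q (x - y) \<bullet> h)"
      using g by (rule integrable_inner_left)
    then show ?thesis
      using k[of "x + h"] k[of x] integral_inner_left[OF g, of h]
      by (simp add: R_def potential_def grad_conv_def)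
  qed
  \<comment> \<open>A bound for the quotients with \<open>norm h \<le> 1\<close> that does not depend on \<open>h\<close>.\<close>
  define w where "w y = 2 * (norm (x - y) powr (q - 1) + 1) + q * norm (x - y) powr (q - 1)" for y
  have R_le: "\<bar>R h y\<bar> \<le> w y" if "y \<noteq> x" "h \<noteq> 0" "norm h \<le> 1" for h y
  proof -
    have d: "\<bar>norm (x + h - y) - norm (x - y)\<bar> \<le> norm h"
      using norm_triangle_ineq3[of "x + h - y" "x - y"] by simp
    have "\<bar>norm (x + h - y) powr q - norm (x - y) powr q\<bar> \<le>
        2 * (norm (x - y) powr (q - 1) + 1) * \<bar>norm (x + h - y) - norm (x - y)\<bar>"
      using that d q by (intro powr_increment_le) auto
    also have "\<dots> \<le> 2 * (norm (x - y) powr (q - 1) + 1) * norm h"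
      using d by (intro mult_left_mono) (auto intro: add_nonneg_nonneg)
    finally have 1: "\<bar>norm (x + h - y) powr q - norm (x - y) powr q\<bar> \<le>
      2 * (norm (x - y) powr (q - 1) + 1) * norm h" .
    have 2: "\<bar>grad_kernel q (x - y) \<bullet> h\<bar> \<le> q * norm (x - y) powr (q - 1) * norm h"
      using Cauchy_Schwarz_ineq2[of "grad_kernel q (x - y)" h] q by (simp add: norm_grad_kernel)
    have "\<bar>R h y\<bar> * norm h \<le> w y * norm h"
      using 1 2 that by (simp add: R_def w_def distrib_right)
    then show ?thesis using that by simp
  qed
  have "(\<lambda>n. LINT y|\<mu>. R (H n) y) \<longlonglongrightarrow> 0"
    if H: "\<And>n. H n \<noteq> 0" "H \<longlonglongrightarrow> 0" for H :: "nat \<Rightarrow> 'a"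
  proof -
    have "\<forall>\<^sub>F n in sequentially. norm (H n) < 1"
      using tendsto_norm[OF H(2)] by (intro order_tendstoD) auto
    then obtain n0 where n0: "\<And>n. n \<ge> n0 \<Longrightarrow> norm (H n) < 1"
      by (auto simp: eventually_sequentially)
    \<comment> \<open>The bound holds for increments of norm at most \<open>1\<close> only, so the first \<open>n0\<close> terms are dropped.\<close>
    have "(\<lambda>n. LINT y|\<mu>. R (H (n + n0)) y) \<longlonglongrightarrow> (LINT y|\<mu>. 0)"
    proof (rule integral_dominated_convergence[where w = w])
      show "integrable \<mu> w" unfolding w_def using i by simp
      show "AE y in \<mu>. (\<lambda>n. R (H (n + n0)) y) \<longlonglongrightarrow> 0"
        using ne
      proof eventually_elim
        case (elim y)
        have "((\<lambda>z. norm (z - y) powr q) has_derivative (\<lambda>h. - grad_kernel q (x - y) \<bullet> h)) (at x)"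
          by (rule has_derivative_compose[of "\<lambda>z. z - y" "\<lambda>h. h" x UNIV "\<lambda>z. norm z powr q",
                OF _ has_derivative_norm_powr])
             (use elim in \<open>auto intro!: derivative_eq_intros\<close>)
        then have "(\<lambda>h. norm (norm (x + h - y) powr q - norm (x - y) powr q -
             (- grad_kernel q (x - y)) \<bullet> h) / norm h) \<midarrow>0\<rightarrow> 0"
          by (simp add: has_derivative_at)
        then have "(\<lambda>h. R h y) \<midarrow>0\<rightarrow> 0"
          unfolding R_def by (subst tendsto_norm_zero_iff[symmetric]) simp
        then have "(\<lambda>n. R (H n) y) \<longlonglongrightarrow> 0"
          using H by (auto simp: tendsto_at_iff_sequentially o_def)
        then show ?case by (rule LIMSEQ_ignore_initial_segment)
      qed
      show "AE y in \<mu>. norm (R (H (n + n0)) y) \<le> w y" for n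
        using ne by eventually_elim (use R_le H n0[of "n + n0"] in auto)
    qed (unfold R_def w_def, measurable)
    then show ?thesis by (simp add: LIMSEQ_offset)
  qed
  then have "(\<lambda>h. LINT y|\<mu>. R h y) \<midarrow>0\<rightarrow> 0"
    by (auto simp: tendsto_at_iff_sequentially o_def)
  then have "(\<lambda>h. (potential q \<mu> (x + h) - potential q \<mu> x - (- grad_conv q \<mu> x) \<bullet> h) / norm h) \<midarrow>0\<rightarrow> 0"
    by (simp only: R_integral)
  from tendsto_norm_zero[OF this] show ?thesis
    by (simp add: has_derivative_at bounded_linear_minus bounded_linear_inner_right)
qed

text \<open>The threshold \<open>d / (d - a)\<close> is the one for which the conjugate exponent \<open>P / (P - 1)\<close> leaves the
singularity \<open>|z| powr - a\<close> integrable near the origin.\<close>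

lemma dual_exponent_less:
  fixes P d a :: real
  assumes "0 < d" "0 \<le> a" "a < d" "d / (d - a) < P"
  shows "1 < P" "a * (P / (P - 1)) < d"
proof -
  have "1 \<le> d / (d - a)" using assms by simp
  then show P: "1 < P" using assms by linarith
  have "d < P * (d - a)" using assms by (simp add: field_simps)
  then show "a * (P / (P - 1)) < d" using P by (simp add: field_simps)
qed

text \<open>Away from \<open>x\<close> the integrand is at most \<open>1\<close>. Near \<open>x\<close>, an essentially bounded density reduces the
claim to Lebesgue measure, and otherwise Young's inequality splits the product of the density and
the singularity into their powers with exponents \<open>P\<close> and \<open>P / (P - 1)\<close>, both integrable.\<close>

lemma integrable_norm_powr_measure_in_Lp:
  fixes \<mu> :: "'a::euclidean_space measure"
  assumes m: "sets \<mu> = sets borel" "prob_space \<mu>"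
    and Lp: "measure_in_Lp p \<mu>"
    and a: "0 \<le> a" "a < real DIM('a)" and p: "ereal (real DIM('a) / (real DIM('a) - a)) < p"
  shows "integrable \<mu> (\<lambda>y. norm (x - y) powr - a)"
proof -
  note [measurable_cong] = m(1)
  interpret prob_space \<mu> by fact
  obtain f where f0: "\<And>y. 0 \<le> f y" and Lf: "mem_Lp p f" and \<mu>f: "\<mu> = density lborel (\<lambda>y. ennreal (f y))"
    using Lp by (auto simp: measure_in_Lp_def)
  have [measurable]: "f \<in> borel_measurable borel" using Lf by (simp add: mem_Lp_def)
  have [measurable]: "ball y r \<in> sets borel" for y :: 'a and r by simp
  have shift: "(\<integral>\<^sup>+y. ennreal (norm (x - y) powr - b) * indicator (ball x 1) y \<partial>lborel) < \<infinity>"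
    if "0 \<le> b" "b < real DIM('a)" for b
  proof -
    have "(\<integral>\<^sup>+y. ennreal (norm (x - y) powr - b) * indicator (ball x 1) y \<partial>(lborel :: 'a measure)) =
      (\<integral>\<^sup>+y. ennreal (norm (x - y) powr - b) * indicator (ball x 1) y \<partial>(distr lborel borel ((+) x)))"
      by (subst lborel_distr_plus) simp
    also have "\<dots> = (\<integral>\<^sup>+z. ennreal (norm z powr - b) * indicator (ball 0 1) z \<partial>(lborel :: 'a measure))"
      by (subst nn_integral_distr) (auto intro!: nn_integral_cong split: split_indicator simp: dist_norm)
    finally show ?thesis
      using nn_integral_norm_powr_unit_ball[OF that] by simp
  qed
  have ball: "(\<integral>\<^sup>+y. ennreal (norm (x - y) powr - a) * indicator (ball x 1) y \<partial>\<mu>) < \<infinity>"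
  proof (cases "p = \<infinity>")
    case True
    then obtain C where C: "AE y in lborel. \<bar>f y\<bar> \<le> C" using Lf by (auto simp: mem_Lp_def)
    have "(\<integral>\<^sup>+y. ennreal (norm (x - y) powr - a) * indicator (ball x 1) y \<partial>\<mu>) =
      (\<integral>\<^sup>+y. ennreal (f y) * (ennreal (norm (x - y) powr - a) * indicator (ball x 1) y) \<partial>lborel)"
      unfolding \<mu>f by (subst nn_integral_density) auto
    also have "\<dots> \<le> (\<integral>\<^sup>+y. ennreal C * (ennreal (norm (x - y) powr - a) * indicator (ball x 1) y) \<partial>lborel)"
      by (intro nn_integral_mono_AE) (use C in eventually_elim, auto intro!: mult_right_mono ennreal_leI)
    also have "\<dots> = ennreal C * (\<integral>\<^sup>+y. ennreal (norm (x - y) powr - a) * indicator (ball x 1) y \<partial>lborel)"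
      by (subst nn_integral_cmult) auto
    also have "\<dots> < \<infinity>"
      using shift[OF a] by (simp add: ennreal_mult_less_top)
    finally show ?thesis .
  next
    case False
    with p obtain P where P: "p = ereal P" "real DIM('a) / (real DIM('a) - a) < P"
      by (cases p) auto
    define Q where "Q = P / (P - 1)"
    have P1: "1 < P" and aQ: "a * Q < real DIM('a)"
      using dual_exponent_less[of "real DIM('a)" a P] a P by (auto simp: Q_def)
    have Q1: "1 < Q" and PQ: "1 / P + 1 / Q = 1" using P1 by (auto simp: Q_def field_simps)
    have fP: "integrable lborel (\<lambda>y. f y powr P)"
      using Lf False P f0 by (simp add: mem_Lp_def)
    have young: "f y * norm (x - y) powr - a \<le> f y powr P + norm (x - y) powr - (a * Q)" for y
    proof -
      have "f y * norm (x - y) powr - a \<le>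
          f y powr P / P + (norm (x - y) powr - a) powr Q / Q"
        using P1 Q1 PQ f0 by (intro Youngs_inequality) auto
      also have "\<dots> \<le> f y powr P + (norm (x - y) powr - a) powr Q"
        using P1 Q1 by (intro add_mono) (auto simp: divide_le_eq mult_left_le mult_le_cancel_left1)
      finally show ?thesis by (simp add: powr_powr)
    qed
    have "(\<integral>\<^sup>+y. ennreal (norm (x - y) powr - a) * indicator (ball x 1) y \<partial>\<mu>) =
      (\<integral>\<^sup>+y. ennreal (f y) * (ennreal (norm (x - y) powr - a) * indicator (ball x 1) y) \<partial>lborel)"
      unfolding \<mu>f by (subst nn_integral_density) auto
    also have "\<dots> \<le> (\<integral>\<^sup>+y. ennreal (f y powr P) +
        ennreal (norm (x - y) powr - (a * Q)) * indicator (ball x 1) y \<partial>lborel)"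
      using young f0 by (intro nn_integral_mono)
        (auto split: split_indicator simp: ennreal_mult[symmetric] ennreal_plus[symmetric] simp del: ennreal_plus intro!: ennreal_leI)
    also have "\<dots> = (\<integral>\<^sup>+y. ennreal (f y powr P) \<partial>lborel) +
        (\<integral>\<^sup>+y. ennreal (norm (x - y) powr - (a * Q)) * indicator (ball x 1) y \<partial>lborel)"
      by (intro nn_integral_add) auto
    also have "\<dots> < \<infinity>"
      using shift[of "a * Q"] a Q1 aQ fP by (auto simp: integrable_iff_bounded)
    finally show ?thesis .
  qed
  have "(\<integral>\<^sup>+y. ennreal (norm (x - y) powr - a) \<partial>\<mu>) \<le>
      (\<integral>\<^sup>+y. ennreal (norm (x - y) powr - a) * indicator (ball x 1) y + 1 \<partial>\<mu>)"
  proof (intro nn_integral_mono)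
    fix y
    have "norm (x - y) powr - a \<le> 1" if "y \<notin> ball x 1"
    proof -
      have "norm (x - y) powr - a \<le> 1 powr - a"
        using that a by (intro powr_mono2') (auto simp: dist_norm)
      then show ?thesis by simp
    qed
    then show "ennreal (norm (x - y) powr - a) \<le> ennreal (norm (x - y) powr - a) * indicator (ball x 1) y + 1"
      by (cases "y \<in> ball x 1") (auto simp: ennreal_le_1)
  qed
  also have "\<dots> = (\<integral>\<^sup>+y. ennreal (norm (x - y) powr - a) * indicator (ball x 1) y \<partial>\<mu>) + 1"
    by (subst nn_integral_add) (auto simp: emeasure_space_1)
  also have "\<dots> < \<infinity>" using ball by auto
  finally show ?thesis by (auto simp: integrable_iff_bounded)
qed

text \<open>For \<open>q < 1\<close> the singularity of order \<open>1 - q\<close> requires \<open>p > d / (d + q - 1)\<close>. This number is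
\<open>1 / q\<close> in dimension one, and it is smaller than \<open>d / (d + q - 2)\<close> whenever the latter is
positive. For \<open>q \<ge> 1\<close> there is no singularity and the moment condition suffices.\<close>

lemma integrable_singular_kernel:
  fixes \<mu> :: "'a::euclidean_space measure"
  assumes q: "0 < q" "q < 2"
    and cases_pq:
      "(real DIM('a) + q - 2 > 0 \<and> ereal (real DIM('a) / (real DIM('a) + q - 2)) < p) \<or>
       (DIM('a) = 1 \<and> q = 1 \<and> p = \<infinity>) \<or>
       (DIM('a) = 1 \<and> q < 1 \<and> ereal (1 / q) < p)"
    and \<mu>: "\<mu> \<in> prob_moment (max 1 q)" "measure_in_Lp p \<mu>"
  shows "integrable \<mu> (\<lambda>y. norm (x - y) powr (q - 1))"
proof (cases "q < 1")
  case True
  define d where "d = real DIM('a)"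
  have d: "d \<ge> 1" using DIM_positive[where 'a = 'a] unfolding d_def by linarith
  have "d / (d - (1 - q)) \<le> d / (d + q - 2)" if "d + q - 2 > 0"
    using that d by (intro divide_left_mono) auto
  then have "ereal (d / (d - (1 - q))) < p"
    using cases_pq True by (auto simp: d_def intro: le_less_trans[of _ "ereal (d / (d + q - 2))"])
  then have "integrable \<mu> (\<lambda>y. norm (x - y) powr - (1 - q))"
    using prob_momentD[OF \<mu>(1)] \<mu>(2) True q d
    by (intro integrable_norm_powr_measure_in_Lp[where p = p]) (auto simp: d_def[symmetric])
  then show ?thesis by simp
next
  case False
  interpret prob_space \<mu> using prob_momentD[OF \<mu>(1)] by simp
  note [measurable_cong] = prob_momentD(1)[OF \<mu>(1)]
  show ?thesis
  proof (cases "q = 1")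
    case True
    have "integrable \<mu> (\<lambda>y. norm (x - y) powr 0)"
      by (rule integrable_const_bound[of _ 1]) auto
    then show ?thesis using True by simp
  next
    case ne: False
    have "\<mu> \<in> prob_moment (q - 1)"
      using \<mu>(1) by (rule prob_moment_mono) (use False ne in auto)
    then show ?thesis using False ne by (intro integrable_potential_kernel) auto
  qed
qed

lemma AE_neq_measure_in_Lp:
  fixes \<mu> :: "'a::euclidean_space measure"
  assumes "measure_in_Lp p \<mu>"
  shows "AE y in \<mu>. y \<noteq> x"
proof -
  obtain f where f: "mem_Lp p f" and \<mu>f: "\<mu> = density lborel (\<lambda>y. ennreal (f y))"
    using assms by (auto simp: measure_in_Lp_def)
  then have "(\<lambda>y. ennreal (f y)) \<in> borel_measurable lborel" by (auto simp: mem_Lp_def)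
  moreover have "AE y in lborel. y \<noteq> x" by (rule AE_lborel_singleton)
  ultimately show ?thesis unfolding \<mu>f by (subst AE_density) auto
qed

section \<open>Decay of the energy along the particle flow\<close>

lemma grad_kernel_minus: "grad_kernel q (y - x) = - grad_kernel q (x - y)"
  by (simp add: grad_kernel_def norm_minus_commute algebra_simps)

text \<open>Newton's third law: the work done by a pair force on relative displacements is the work of the
resultant force on the single displacements, counted twice.\<close>

lemma sum_antisymmetric_inner:
  fixes g :: "'b \<Rightarrow> 'b \<Rightarrow> 'a::real_inner"
  assumes "\<And>i j. i \<in> I \<Longrightarrow> j \<in> I \<Longrightarrow> g j i = - g i j"
  shows "(\<Sum>i\<in>I. \<Sum>j\<in>I. g i j \<bullet> (v i - v j)) = 2 * (\<Sum>i\<in>I. (\<Sum>j\<in>I. g i j) \<bullet> v i)"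
proof -
  have "(\<Sum>i\<in>I. \<Sum>j\<in>I. g i j \<bullet> v j) = (\<Sum>j\<in>I. \<Sum>i\<in>I. g i j \<bullet> v j)"
    by (rule sum.swap)
  also have "\<dots> = - (\<Sum>j\<in>I. \<Sum>i\<in>I. g j i \<bullet> v j)"
    unfolding sum_negf[symmetric] by (intro sum.cong refl) (subst assms, auto)
  finally show ?thesis
    by (simp add: inner_diff_right sum_subtractf inner_sum_left)
qed

text \<open>The diagonal term is \<open>grad_kernel q 0 = 0\<close>. With a full double sum the pair forces can be exchanged.\<close>

lemma velocity_eq_sum_all:
  "velocity q \<mu> N x i = - ((1 / real N) *\<^sub>R (\<Sum>j\<in>{1..N}. grad_kernel q (x i - x j))) + grad_conv q \<mu> (x i)"
proof -
  have "(\<Sum>j\<in>{1..N} - {i}. grad_kernel q (x i - x j)) = (\<Sum>j\<in>{1..N}. grad_kernel q (x i - x j))"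
    by (intro sum.mono_neutral_left) (auto simp: grad_kernel_def)
  then show ?thesis by (simp add: velocity_def)
qed

text \<open>Energy dissipation. The velocity of particle \<open>i\<close> is \<open>- N\<close> times the gradient of the discrepancy
with respect to the position of that particle, so the chain rule gives minus the average of the
squared speeds. Collision-freeness makes every pair term differentiable, and the potential is
differentiable at every point.\<close>

lemma has_real_derivative_MMD2:
  fixes \<mu> :: "'a::euclidean_space measure" and X :: "nat \<Rightarrow> real \<Rightarrow> 'a"
  assumes q: "0 < q" "q < 2" and \<mu>: "\<mu> \<in> prob_moment q"
    and i: "\<And>x. integrable \<mu> (\<lambda>y. norm (x - y) powr (q - 1))"
    and ne: "\<And>x. AE y in \<mu>. y \<noteq> x"
    and N: "N \<ge> 1" and sol: "collision_free_solution q \<mu> N X" and t: "0 \<le> t"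
  shows "((\<lambda>t. MMD2 q (empirical N (\<lambda>i. X i t)) \<mu>) has_real_derivative
    - (\<Sum>i\<in>{1..N}. (norm (velocity q \<mu> N (\<lambda>j. X j t) i))\<^sup>2) / real N) (at t within {0..})"
proof -
  define v where "v i = velocity q \<mu> N (\<lambda>j. X j t) i" for i
  define x where "x i = X i t" for i
  define G where "G i = grad_conv q \<mu> (x i)" for i
  define g where "g i j = grad_kernel q (x i - x j)" for i j
  have X: "(X i has_derivative (\<lambda>h. h *\<^sub>R v i)) (at t within {0..})" if "i \<in> {1..N}" for i
    using sol t that unfolding v_def collision_free_solution_def has_vector_derivative_def by auto
  have inj: "x i \<noteq> x j" if "i \<in> {1..N}" "j \<in> {1..N}" "i \<noteq> j" for i j
    using sol t that unfolding x_def collision_free_solution_def by (metis inj_onD)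
  have d1: "((\<lambda>t. potential q \<mu> (X i t)) has_real_derivative - G i \<bullet> v i) (at t within {0..})"
    if "i \<in> {1..N}" for i
  proof -
    have "((\<lambda>t. potential q \<mu> (X i t)) has_derivative (\<lambda>h. - G i \<bullet> (h *\<^sub>R v i))) (at t within {0..})"
      unfolding G_def x_def
      by (rule has_derivative_compose[OF X[OF that] has_derivative_potential]) (use q \<mu> i ne in auto)
    moreover have "(\<lambda>h. - G i \<bullet> (h *\<^sub>R v i)) = (*) (- G i \<bullet> v i)"
      by (simp add: fun_eq_iff)
    ultimately show ?thesis by (simp only: has_field_derivative_def)
  qed
  have d2: "((\<lambda>t. norm (X i t - X j t) powr q) has_real_derivative - g i j \<bullet> (v i - v j)) (at t within {0..})"
    if "i \<in> {1..N}" "j \<in> {1..N} - {i}" for i j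
  proof -
    have "((\<lambda>t. X i t - X j t) has_derivative (\<lambda>h. h *\<^sub>R v i - h *\<^sub>R v j)) (at t within {0..})"
      using that by (intro has_derivative_diff X) auto
    from has_derivative_compose[OF this has_derivative_norm_powr[of "X i t - X j t" q]]
    have "((\<lambda>t. norm (X i t - X j t) powr q) has_derivative
        (\<lambda>h. - g i j \<bullet> (h *\<^sub>R v i - h *\<^sub>R v j))) (at t within {0..})"
      using inj[of i j] that by (auto simp: g_def x_def)
    moreover have "(\<lambda>h. - g i j \<bullet> (h *\<^sub>R v i - h *\<^sub>R v j)) = (*) (- g i j \<bullet> (v i - v j))"
      by (simp add: fun_eq_iff scaleR_diff_right[symmetric])
    ultimately show ?thesis by (simp only: has_field_derivative_def)
  qed
  have "((\<lambda>t. (\<Sum>i\<in>{1..N}. potential q \<mu> (X i t)) / real N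
      - (\<Sum>i\<in>{1..N}. \<Sum>j\<in>{1..N} - {i}. norm (X i t - X j t) powr q) / (2 * (real N)\<^sup>2)
      - mutual_energy q \<mu> \<mu> / 2) has_real_derivative
      (\<Sum>i\<in>{1..N}. - G i \<bullet> v i) / real N
      - (\<Sum>i\<in>{1..N}. \<Sum>j\<in>{1..N} - {i}. - g i j \<bullet> (v i - v j)) / (2 * (real N)\<^sup>2) - 0) (at t within {0..})"
    by (intro DERIV_diff DERIV_cdivide DERIV_sum DERIV_const d1 d2)
  moreover have "(\<Sum>i\<in>{1..N}. - G i \<bullet> v i) / real N
      - (\<Sum>i\<in>{1..N}. \<Sum>j\<in>{1..N} - {i}. - g i j \<bullet> (v i - v j)) / (2 * (real N)\<^sup>2) - 0 =
      - (\<Sum>i\<in>{1..N}. (norm (v i))\<^sup>2) / real N"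
  proof -
    have "(\<Sum>i\<in>{1..N}. \<Sum>j\<in>{1..N} - {i}. - g i j \<bullet> (v i - v j)) =
       - (\<Sum>i\<in>{1..N}. \<Sum>j\<in>{1..N}. g i j \<bullet> (v i - v j))"
      unfolding sum_negf[symmetric] by (intro sum.cong refl sum.mono_neutral_cong_left) auto
    also have "\<dots> = - (2 * (\<Sum>i\<in>{1..N}. (\<Sum>j\<in>{1..N}. g i j) \<bullet> v i))"
      by (subst sum_antisymmetric_inner) (auto simp: g_def intro: grad_kernel_minus)
    finally have s: "(\<Sum>i\<in>{1..N}. \<Sum>j\<in>{1..N} - {i}. - g i j \<bullet> (v i - v j)) =
      - (2 * (\<Sum>i\<in>{1..N}. (\<Sum>j\<in>{1..N}. g i j) \<bullet> v i))" .
    \<comment> \<open>Up to the factor \<open>- 1 / N\<close>, this is what multiplies \<open>v i\<close> in the derivative.\<close>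
    have v: "v i = - ((1 / real N) *\<^sub>R (\<Sum>j\<in>{1..N}. g i j)) + G i" for i
      by (simp add: v_def velocity_eq_sum_all g_def G_def x_def)
    have "(norm (v i))\<^sup>2 = G i \<bullet> v i - (\<Sum>j\<in>{1..N}. g i j) \<bullet> v i / real N" for i
      unfolding power2_norm_eq_inner by (subst (1) v) (simp add: inner_add_left inner_diff_left)
    then have S: "(\<Sum>i\<in>{1..N}. (norm (v i))\<^sup>2) =
       (\<Sum>i\<in>{1..N}. G i \<bullet> v i) - (\<Sum>i\<in>{1..N}. (\<Sum>j\<in>{1..N}. g i j) \<bullet> v i) / real N"
      by (simp add: sum_subtractf sum_divide_distrib)
    show ?thesis
      unfolding s S by (simp add: sum_negf power2_eq_square diff_divide_distrib)
  qed
  ultimately show ?thesis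
    unfolding MMD2_empirical[OF N \<mu> q(1)] v_def by simp
qed

lemma MMD2_antimono:
  fixes \<mu> :: "'a::euclidean_space measure" and X :: "nat \<Rightarrow> real \<Rightarrow> 'a"
  assumes q: "0 < q" "q < 2" and \<mu>: "\<mu> \<in> prob_moment q"
    and i: "\<And>x. integrable \<mu> (\<lambda>y. norm (x - y) powr (q - 1))"
    and ne: "\<And>x. AE y in \<mu>. y \<noteq> x"
    and N: "N \<ge> 1" and sol: "collision_free_solution q \<mu> N X" and t: "0 \<le> t"
  shows "MMD2 q (empirical N (\<lambda>i. X i t)) \<mu> \<le> MMD2 q (empirical N (\<lambda>i. X i 0)) \<mu>"
proof (rule DERIV_nonpos_imp_decreasing_open[OF t])
  note d = has_real_derivative_MMD2[OF q \<mu> i ne N sol]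
  show "continuous_on {0..t} (\<lambda>t. MMD2 q (empirical N (\<lambda>i. X i t)) \<mu>)"
    by (rule continuous_on_subset[of "{0..}"]) (auto intro: DERIV_continuous_on d)
  fix s assume s: "0 < s" "s < t"
  then have "at s within {0..} = at s" by (intro at_within_interior) auto
  then show "\<exists>y. ((\<lambda>t. MMD2 q (empirical N (\<lambda>i. X i t)) \<mu>) has_real_derivative y) (at s) \<and> y \<le> 0"
    using d[of s] s by (intro exI[of _ "- (\<Sum>i\<in>{1..N}. (norm (velocity q \<mu> N (\<lambda>j. X j s) i))\<^sup>2) / real N"])
      (auto simp: divide_nonpos_nonneg sum_nonneg)
qed

section \<open>Positive definiteness of Gaussian kernels\<close>

definition gauss :: "real \<Rightarrow> 'a::euclidean_space \<Rightarrow> real" where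
  "gauss s z = exp (- s * (norm z)\<^sup>2)"

definition gauss_integral :: "'a::euclidean_space itself \<Rightarrow> real \<Rightarrow> real" where
  "gauss_integral _ s = (LINT z|(lborel :: 'a measure). gauss s z)"

definition gauss_energy :: "real \<Rightarrow> 'a::euclidean_space measure \<Rightarrow> 'a measure \<Rightarrow> real" where
  "gauss_energy s \<alpha> \<beta> = (LINT p|(\<alpha> \<Otimes>\<^sub>M \<beta>). gauss s (fst p - snd p))"

text \<open>The rate is \<open>2 * s\<close>, because the convolution of two Gaussians of rate \<open>2 * s\<close> is a multiple of the
Gaussian of rate \<open>s\<close>, which is the kernel of \<open>gauss_energy s\<close>.\<close>

definition gauss_smooth :: "real \<Rightarrow> 'a::euclidean_space measure \<Rightarrow> 'a \<Rightarrow> real" where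
  "gauss_smooth s \<alpha> z = (LINT x|\<alpha>. gauss (2 * s) (x - z))"

text \<open>The quadratic form of the Gaussian kernel at the signed measure \<open>\<rho> - \<mu>\<close>.\<close>

definition gauss_discrepancy :: "real \<Rightarrow> 'a::euclidean_space measure \<Rightarrow> 'a measure \<Rightarrow> real" where
  "gauss_discrepancy s \<rho> \<mu> = gauss_energy s \<rho> \<rho> + gauss_energy s \<mu> \<mu> - 2 * gauss_energy s \<rho> \<mu>"

lemma gauss_nonneg [simp]: "0 \<le> gauss s z"
  by (simp add: gauss_def)

lemma gauss_le_1 [simp]: "0 \<le> s \<Longrightarrow> gauss s z \<le> 1"
  by (simp add: gauss_def)

lemma gauss_minus_commute: "gauss s (x - y) = gauss s (y - x)"
  by (simp add: gauss_def norm_minus_commute)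

lemma borel_measurable_gauss [measurable]: "gauss s \<in> borel_measurable borel"
  unfolding gauss_def[abs_def] by measurable

lemma gauss_antimono: "s \<le> t \<Longrightarrow> gauss t z \<le> gauss s z"
  by (simp add: gauss_def mult_right_mono)

text \<open>By the parallelogram law, completing the square in \<open>z\<close> around the midpoint of \<open>x\<close> and \<open>y\<close>.\<close>

lemma gauss_product:
  fixes x y z :: "'a::euclidean_space"
  shows "gauss (2 * s) (x - z) * gauss (2 * s) (y - z) =
    gauss s (x - y) * gauss (4 * s) (z - (1 / 2) *\<^sub>R (x + y))"
proof -
  have "2 * (norm (x - z))\<^sup>2 + 2 * (norm (y - z))\<^sup>2 =
    (norm (x - y))\<^sup>2 + 4 * (norm (z - (1 / 2) *\<^sub>R (x + y)))\<^sup>2"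
    by (simp add: power2_norm_eq_inner inner_diff_left inner_diff_right inner_add_left
      inner_add_right inner_commute algebra_simps)
  then have "s * (2 * (norm (x - z))\<^sup>2 + 2 * (norm (y - z))\<^sup>2) =
    s * ((norm (x - y))\<^sup>2 + 4 * (norm (z - (1 / 2) *\<^sub>R (x + y)))\<^sup>2)" by simp
  then show ?thesis
    by (simp add: gauss_def exp_add[symmetric] algebra_simps)
qed

lemma integrable_gauss:
  assumes "0 < s"
  shows "integrable lborel (\<lambda>z::'a::euclidean_space. gauss s (z - x))"
    and "(LINT z|lborel. gauss s (z - x)) = gauss_integral TYPE('a) s"
proof -
  have i: "integrable lborel (gauss s :: 'a \<Rightarrow> real)"
    using nn_integral_gaussian[OF assms, where 'a = 'a] by (simp add: integrable_iff_bounded gauss_def)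
  have l: "lborel = distr lborel borel ((+) (- x))"
    by (simp add: lborel_distr_plus)
  have "integrable (distr lborel borel ((+) (- x))) (gauss s :: 'a \<Rightarrow> real)"
    using i l by metis
  then show "integrable lborel (\<lambda>z::'a. gauss s (z - x))"
    by (subst (asm) integrable_distr_eq) auto
  have "gauss_integral TYPE('a) s = (LINT z|distr lborel borel ((+) (- x)). gauss s z)"
    unfolding gauss_integral_def using l by metis
  also have "\<dots> = (LINT z|lborel. gauss s (z - x))"
    by (subst integral_distr) auto
  finally show "(LINT z|lborel. gauss s (z - x)) = gauss_integral TYPE('a) s" by simp
qed

text \<open>The integrand is at least \<open>exp (- 1)\<close> on the ball of radius \<open>1 / sqrt s\<close>. The bound decays only
polynomially in \<open>s\<close>, which will beat the exponentially small Gaussian tails.\<close>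

lemma gauss_integral_ge:
  assumes "0 < s"
  shows "exp (- 1) * measure lborel (ball (0::'a::euclidean_space) (1 / sqrt s)) \<le> gauss_integral TYPE('a) s"
proof -
  have "exp (- 1) * measure lborel (ball (0::'a) (1 / sqrt s)) =
    (LINT z::'a|lborel. exp (- 1) * indicator (ball (0::'a) (1 / sqrt s)) z)"
    by simp
  also have "\<dots> \<le> (LINT z::'a|lborel. gauss s z)"
  proof (rule integral_mono)
    show "integrable lborel (\<lambda>z. exp (- 1) * indicat_real (ball (0::'a) (1 / sqrt s)) z)"
      by (intro integrable_mult_right integrable_real_indicator emeasure_lborel_ball_finite) auto
    show "integrable lborel (gauss s :: 'a \<Rightarrow> real)"
      using integrable_gauss(1)[OF assms, of 0] by simp
    fix z :: 'a
    show "exp (- 1) * indicator (ball (0::'a) (1 / sqrt s)) z \<le> gauss s z"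
    proof (cases "z \<in> ball 0 (1 / sqrt s)")
      case True
      then have "(norm z)\<^sup>2 \<le> (1 / sqrt s)\<^sup>2" by (intro power_mono) auto
      then have "s * (norm z)\<^sup>2 \<le> 1" using assms by (simp add: power_divide field_simps)
      then show ?thesis using True by (simp add: gauss_def)
    qed simp
  qed
  finally show ?thesis by (simp add: gauss_integral_def)
qed

lemma gauss_integral_pos:
  assumes "0 < s" shows "0 < gauss_integral TYPE('a::euclidean_space) s"
proof -
  have "0 < exp (- 1) * measure lborel (ball (0::'a) (1 / sqrt s))"
    using assms by (intro mult_pos_pos content_ball_pos) auto
  then show ?thesis using gauss_integral_ge[OF assms, where 'a = 'a] by linarith
qed

lemma gauss_integral_antimono:
  assumes "0 < s" "s \<le> t"
  shows "gauss_integral TYPE('a::euclidean_space) t \<le> gauss_integral TYPE('a) s"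
  unfolding gauss_integral_def
  using integrable_gauss(1)[of s "0::'a"] integrable_gauss(1)[of t "0::'a"] assms
  by (intro integral_mono) (auto intro: gauss_antimono)

context
  fixes \<alpha> \<beta> :: "'a::euclidean_space measure"
  assumes sets_ab [measurable_cong]: "sets \<alpha> = sets borel" "sets \<beta> = sets borel"
    and prob_ab: "prob_space \<alpha>" "prob_space \<beta>"
begin

interpretation a: prob_space \<alpha> by (rule prob_ab)
interpretation b: prob_space \<beta> by (rule prob_ab)
interpretation ab: pair_prob_space \<alpha> \<beta> ..

text \<open>Integrating the identity \<open>gauss_product\<close> over \<open>z\<close>: the second factor contributes the same constant
for every pair of points.\<close>

lemma smooth_product:
  assumes s: "0 < s"
  shows "integrable lborel (\<lambda>z. gauss_smooth s \<alpha> z * gauss_smooth s \<beta> z)"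
    and "(LINT z|lborel. gauss_smooth s \<alpha> z * gauss_smooth s \<beta> z) =
      gauss_integral TYPE('a) (4 * s) * gauss_energy s \<alpha> \<beta>"
proof -
  define F where "F p z = gauss (2 * s) (fst p - z) * gauss (2 * s) (snd p - z)"
    for p :: "'a \<times> 'a" and z
  have F: "F p z = gauss s (fst p - snd p) * gauss (4 * s) (z - (1 / 2) *\<^sub>R (fst p + snd p))" for p z
    unfolding F_def by (rule gauss_product)
  have Fz: "integrable lborel (F p)"
    "(LINT z|lborel. F p z) = gauss s (fst p - snd p) * gauss_integral TYPE('a) (4 * s)" for p
    unfolding F[abs_def] using s integrable_gauss[of "4 * s" "(1 / 2) *\<^sub>R (fst p + snd p)"] by simp_all
  have [measurable]: "(\<lambda>(p, z). F p z) \<in> borel_measurable ((\<alpha> \<Otimes>\<^sub>M \<beta>) \<Otimes>\<^sub>M lborel)"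
    unfolding F_def by measurable
  interpret P: pair_sigma_finite "\<alpha> \<Otimes>\<^sub>M \<beta>" "lborel :: 'a measure" ..
  have i: "integrable ((\<alpha> \<Otimes>\<^sub>M \<beta>) \<Otimes>\<^sub>M lborel) (\<lambda>(p, z). F p z)"
  proof (rule P.Fubini_integrable)
    have "(\<lambda>p. LINT z|lborel. norm (F p z)) = (\<lambda>p. gauss s (fst p - snd p) * gauss_integral TYPE('a) (4 * s))"
      using Fz(2) by (simp add: F_def)
    moreover have "integrable (\<alpha> \<Otimes>\<^sub>M \<beta>) (\<lambda>p. gauss s (fst p - snd p) * gauss_integral TYPE('a) (4 * s))"
      using s by (intro integrable_mult_left ab.integrable_const_bound[of _ 1]) auto
    ultimately show "integrable (\<alpha> \<Otimes>\<^sub>M \<beta>) (\<lambda>p. LINT z|lborel. norm (case (p, z) of (p, z) \<Rightarrow> F p z))"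
      by simp
  qed (use Fz in auto)
  have u: "(LINT p|(\<alpha> \<Otimes>\<^sub>M \<beta>). F p z) = gauss_smooth s \<alpha> z * gauss_smooth s \<beta> z" for z
  proof -
    have "integrable (\<alpha> \<Otimes>\<^sub>M \<beta>) (\<lambda>p. F p z)"
      unfolding F_def using s
      by (intro ab.integrable_const_bound[of _ 1]) (auto intro!: mult_le_one)
    from ab.integral_fst'[OF this] show ?thesis
      by (simp add: F_def gauss_smooth_def)
  qed
  show "integrable lborel (\<lambda>z. gauss_smooth s \<alpha> z * gauss_smooth s \<beta> z)"
    using P.integrable_snd[OF i] by (simp add: u)
  show "(LINT z|lborel. gauss_smooth s \<alpha> z * gauss_smooth s \<beta> z) =
      gauss_integral TYPE('a) (4 * s) * gauss_energy s \<alpha> \<beta>"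
    using P.Fubini_integral[OF i] by (simp add: u Fz gauss_energy_def)
qed

end

context
  fixes \<rho> \<mu> :: "'a::euclidean_space measure"
  assumes sets_rm [measurable_cong]: "sets \<rho> = sets borel" "sets \<mu> = sets borel"
    and prob_rm: "prob_space \<rho>" "prob_space \<mu>"
begin

text \<open>The Gaussian discrepancy is, up to a positive constant, the squared \<open>L\<^sup>2\<close> norm of the Gaussian
smoothing of \<open>\<rho> - \<mu>\<close>. This gives its sign, and by Cauchy--Schwarz the control of integrals of
smoothed test functions.\<close>

lemma smooth_difference_L2:
  assumes s: "0 < s"
  shows "integrable lborel (\<lambda>z. (gauss_smooth s \<rho> z - gauss_smooth s \<mu> z)\<^sup>2)"
    and "(LINT z|lborel. (gauss_smooth s \<rho> z - gauss_smooth s \<mu> z)\<^sup>2) =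
      gauss_integral TYPE('a) (4 * s) * gauss_discrepancy s \<rho> \<mu>"
proof -
  have e: "(gauss_smooth s \<rho> z - gauss_smooth s \<mu> z)\<^sup>2 =
    gauss_smooth s \<rho> z * gauss_smooth s \<rho> z + gauss_smooth s \<mu> z * gauss_smooth s \<mu> z -
    2 * (gauss_smooth s \<rho> z * gauss_smooth s \<mu> z)" for z
    by (simp add: power2_eq_square algebra_simps)
  note p = smooth_product[OF sets_rm(1) sets_rm(1) prob_rm(1) prob_rm(1) s]
    smooth_product[OF sets_rm(2) sets_rm(2) prob_rm(2) prob_rm(2) s]
    smooth_product[OF sets_rm(1) sets_rm(2) prob_rm(1) prob_rm(2) s]
  show "integrable lborel (\<lambda>z. (gauss_smooth s \<rho> z - gauss_smooth s \<mu> z)\<^sup>2)"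
    unfolding e using p by simp
  show "(LINT z|lborel. (gauss_smooth s \<rho> z - gauss_smooth s \<mu> z)\<^sup>2) =
      gauss_integral TYPE('a) (4 * s) * gauss_discrepancy s \<rho> \<mu>"
    unfolding e using p by (simp add: gauss_discrepancy_def algebra_simps)
qed

lemma gauss_discrepancy_nonneg:
  assumes "0 < s" shows "0 \<le> gauss_discrepancy s \<rho> \<mu>"
proof -
  have "0 \<le> gauss_integral TYPE('a) (4 * s) * gauss_discrepancy s \<rho> \<mu>"
    unfolding smooth_difference_L2(2)[OF assms, symmetric] by simp
  then show ?thesis
    using gauss_integral_pos[of "4 * s", where 'a = 'a] assms by (simp add: zero_le_mult_iff)
qed

end

text \<open>With \<open>A\<close>, \<open>B\<close> and \<open>C\<close> the integrals of \<open>f\<^sup>2\<close>, \<open>g\<^sup>2\<close> and \<open>f g\<close>, the integral of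
\<open>(B f - C g)\<^sup>2\<close> equals \<open>B (A B - C\<^sup>2)\<close>.\<close>

lemma integral_Cauchy_Schwarz:
  fixes f g :: "'b \<Rightarrow> real"
  assumes f: "integrable M (\<lambda>x. (f x)\<^sup>2)" and g: "integrable M (\<lambda>x. (g x)\<^sup>2)"
    and fg: "integrable M (\<lambda>x. f x * g x)"
  shows "(LINT x|M. f x * g x)\<^sup>2 \<le> (LINT x|M. (f x)\<^sup>2) * (LINT x|M. (g x)\<^sup>2)"
proof -
  define A B C where "A = (LINT x|M. (f x)\<^sup>2)" and "B = (LINT x|M. (g x)\<^sup>2)"
    and "C = (LINT x|M. f x * g x)"
  have "0 \<le> (LINT x|M. (B * f x - C * g x)\<^sup>2)" by simp
  also have "(\<lambda>x. (B * f x - C * g x)\<^sup>2) =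
    (\<lambda>x. B\<^sup>2 * (f x)\<^sup>2 + C\<^sup>2 * (g x)\<^sup>2 - 2 * B * C * (f x * g x))"
    by (simp add: power2_eq_square algebra_simps)
  also have "(LINT x|M. B\<^sup>2 * (f x)\<^sup>2 + C\<^sup>2 * (g x)\<^sup>2 - 2 * B * C * (f x * g x)) =
    B\<^sup>2 * A + C\<^sup>2 * B - 2 * B * C * C"
    using f g fg by (simp add: A_def B_def C_def)
  also have "\<dots> = B * (A * B - C\<^sup>2)" by (simp add: power2_eq_square algebra_simps)
  finally have 1: "0 \<le> B * (A * B - C\<^sup>2)" .
  have B: "B \<ge> 0" by (simp add: B_def)
  show ?thesis
  proof (cases "B = 0")
    case True
    then have "AE x in M. (g x)\<^sup>2 = 0"
      using integral_nonneg_eq_0_iff_AE[OF g] by (simp add: B_def)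
    then have "AE x in M. f x * g x = 0" by eventually_elim simp
    then have "C = 0" unfolding C_def by (rule integral_eq_zero_AE)
    then show ?thesis using True by (simp add: A_def B_def C_def)
  next
    case False
    then have "0 \<le> A * B - C\<^sup>2" using 1 B by (auto simp: zero_le_mult_iff)
    then show ?thesis by (simp add: A_def B_def C_def)
  qed
qed

section \<open>Powers of the distance as mixtures of Gaussians\<close>

text \<open>Up to a constant, the Levy density of the \<open>q / 2\<close>-stable subordinator, extended by zero.\<close>

definition stable_weight :: "real \<Rightarrow> real \<Rightarrow> real" where
  "stable_weight q s = (if 0 < s then s powr (- 1 - q / 2) else 0)"

lemma stable_weight_nonneg [simp]: "0 \<le> stable_weight q s"
  by (simp add: stable_weight_def)

lemma borel_measurable_stable_weight [measurable]: "stable_weight q \<in> borel_measurable borel"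
  unfolding stable_weight_def[abs_def] by measurable

text \<open>Near the origin \<open>1 - exp (- s) \<le> s\<close> leaves the power \<open>- q / 2 > - 1\<close>, and at infinity the power
\<open>- 1 - q / 2 < - 1\<close> is integrable by itself.\<close>

lemma nn_integral_stable_weight:
  assumes q: "0 < q" "q < 2"
  shows "(\<integral>\<^sup>+s. ennreal (stable_weight q s * (1 - exp (- s))) \<partial>lborel) < \<infinity>"
proof -
  have [measurable]: "ball y r \<in> sets borel" for y r :: real by simp
  define e where "e = - 1 - q / 2"
  have "((\<lambda>s::real. s powr e) has_integral -(1 powr (e + 1)) / (e + 1)) {1..}"
    using q by (intro has_integral_powr_to_inf) (auto simp: e_def)
  from nn_integral_has_integral_lebesgue[OF _ this]
  have tail: "(\<integral>\<^sup>+s. ennreal (indicator {1..} s * (s powr e)) \<partial>lborel) < \<infinity>"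
    by simp
  have "(\<integral>\<^sup>+s. ennreal (stable_weight q s * (1 - exp (- s))) \<partial>lborel) \<le>
    (\<integral>\<^sup>+s. ennreal (norm s powr - (q / 2)) * indicator (ball 0 1) s + ennreal (indicator {1..} s * (s powr e)) \<partial>lborel)"
  proof (intro nn_integral_mono)
    fix s :: real
    consider "s \<le> 0" | "0 < s" "s < 1" | "1 \<le> s" by linarith
    then show "ennreal (stable_weight q s * (1 - exp (- s))) \<le>
      ennreal (norm s powr - (q / 2)) * indicator (ball 0 1) s + ennreal (indicator {1..} s * (s powr e))"
    proof cases
      case 2
      have "1 - exp (- s) \<le> s" using exp_ge_add_one_self[of "- s"] by simp
      then have "s powr e * (1 - exp (- s)) \<le> s powr e * s" by (intro mult_left_mono) auto
      also have "\<dots> = s powr - (q / 2)" using 2 by (simp add: e_def mult.commute[of _ s] powr_mult_base)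
      finally show ?thesis using 2 by (simp add: stable_weight_def e_def ennreal_leI)
    next
      case 3
      then have "s powr e * (1 - exp (- s)) \<le> s powr e * 1" by (intro mult_left_mono) auto
      then show ?thesis using 3 by (simp add: stable_weight_def e_def ennreal_leI)
    qed (simp add: stable_weight_def)
  qed
  also have "\<dots> = (\<integral>\<^sup>+s. ennreal (norm (s::real) powr - (q / 2)) * indicator (ball 0 1) s \<partial>lborel) +
      (\<integral>\<^sup>+s. ennreal (indicator {1..} s * ((s::real) powr e)) \<partial>lborel)"
    by (rule nn_integral_add) measurable
  also have "\<dots> < \<infinity>"
    using nn_integral_norm_powr_unit_ball[where 'a = real, of "q / 2"] tail q by simp
  finally show ?thesis .
qed

text \<open>Schoenberg's representation of \<open>|z|\<^sup>q\<close>. The substitution \<open>s = u / r\<^sup>2\<close> pulls the power \<open>r\<^sup>q\<close> out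
of the integral, because the weight is homogeneous.\<close>

lemma powr_gaussian_mixture:
  assumes q: "0 < q" "q < 2"
  obtains C where "0 \<le> C"
    "\<And>r. 0 \<le> r \<Longrightarrow>
      (\<integral>\<^sup>+s. ennreal (stable_weight q s * (1 - exp (- s * r\<^sup>2))) \<partial>lborel) = ennreal (C * r powr q)"
proof -
  obtain C where C: "0 \<le> C"
    "(\<integral>\<^sup>+s. ennreal (stable_weight q s * (1 - exp (- s))) \<partial>lborel) = ennreal C"
    using nn_integral_stable_weight[OF q] by (cases "\<integral>\<^sup>+s. ennreal (stable_weight q s * (1 - exp (- s))) \<partial>lborel") auto
  have "(\<integral>\<^sup>+s. ennreal (stable_weight q s * (1 - exp (- s * r\<^sup>2))) \<partial>lborel) = ennreal (C * r powr q)"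
    if r: "0 \<le> r" for r
  proof (cases "r = 0")
    case False
    with r have r: "0 < r" by simp
    have scale: "stable_weight q (s / r\<^sup>2) = r powr (2 + q) * stable_weight q s" for s
    proof (cases "s > 0")
      case True
      have "(s / r\<^sup>2) powr (- 1 - q / 2) = s powr (- 1 - q / 2) / (r\<^sup>2) powr (- 1 - q / 2)"
        using True r by (simp add: powr_divide)
      also have "(r\<^sup>2) powr (- 1 - q / 2) = r powr - (2 + q)"
      proof -
        have "(r\<^sup>2) powr (- 1 - q / 2) = (r powr 2) powr (- 1 - q / 2)" using r by simp
        also have "\<dots> = r powr - (2 + q)" unfolding powr_powr
          by (rule arg_cong[where f = "\<lambda>e. r powr e"]) (simp add: field_simps)
        finally show ?thesis .
      qed
      also have "s powr (- 1 - q / 2) / r powr - (2 + q) = r powr (2 + q) * s powr (- 1 - q / 2)"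
        unfolding powr_minus[of r "2 + q"] divide_inverse inverse_inverse_eq by (rule mult.commute)
      finally have "(s / r\<^sup>2) powr (- 1 - q / 2) = r powr (2 + q) * s powr (- 1 - q / 2)" .
      moreover have "0 < s / r\<^sup>2" using True r by simp
      ultimately show ?thesis
        using True by (simp only: stable_weight_def if_True)
    qed (use r in \<open>simp add: stable_weight_def zero_less_divide_iff\<close>)
    have "(\<integral>\<^sup>+s. ennreal (stable_weight q s * (1 - exp (- s * r\<^sup>2))) \<partial>lborel) =
      ennreal (1 / r\<^sup>2) * (\<integral>\<^sup>+s. ennreal (stable_weight q (0 + 1 / r\<^sup>2 * s) *
         (1 - exp (- (0 + 1 / r\<^sup>2 * s) * r\<^sup>2))) \<partial>lborel)"
      using r by (subst nn_integral_real_affine[where c = "1 / r\<^sup>2" and t = 0]) auto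
    also have "(\<lambda>s. ennreal (stable_weight q (0 + 1 / r\<^sup>2 * s) * (1 - exp (- (0 + 1 / r\<^sup>2 * s) * r\<^sup>2)))) =
      (\<lambda>s. ennreal (r powr (2 + q)) * ennreal (stable_weight q s * (1 - exp (- s))))"
    proof
      fix s
      show "ennreal (stable_weight q (0 + 1 / r\<^sup>2 * s) * (1 - exp (- (0 + 1 / r\<^sup>2 * s) * r\<^sup>2))) =
        ennreal (r powr (2 + q)) * ennreal (stable_weight q s * (1 - exp (- s)))"
      proof -
        have "0 + 1 / r\<^sup>2 * s = s / r\<^sup>2" "- (s / r\<^sup>2) * r\<^sup>2 = - s" using r by simp_all
        then show ?thesis
          by (simp only: scale mult.assoc ennreal_mult'[OF powr_ge_zero])
      qed
    qed
    also have "ennreal (1 / r\<^sup>2) * (\<integral>\<^sup>+s. ennreal (r powr (2 + q)) * ennreal (stable_weight q s * (1 - exp (- s))) \<partial>lborel)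
      = ennreal (1 / r\<^sup>2) * (ennreal (r powr (2 + q)) * ennreal C)"
      by (subst nn_integral_cmult) (auto simp: C)
    also have "\<dots> = ennreal (1 / r\<^sup>2 * (r powr (2 + q) * C))"
      using C(1) by (simp add: ennreal_mult'[symmetric])
    also have "1 / r\<^sup>2 * (r powr (2 + q) * C) = C * r powr q"
      using r by (simp add: powr_add)
    finally show ?thesis .
  qed simp
  with C(1) show ?thesis by (rule that)
qed

lemma mutual_energy_eq_pair_integral:
  fixes \<alpha> \<beta> :: "'a::euclidean_space measure"
  assumes \<alpha>: "\<alpha> \<in> prob_moment q" and \<beta>: "\<beta> \<in> prob_moment q" and "0 < q"
  shows "mutual_energy q \<alpha> \<beta> = (LINT p|(\<alpha> \<Otimes>\<^sub>M \<beta>). norm (fst p - snd p) powr q)"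
proof -
  interpret a: prob_space \<alpha> using prob_momentD[OF \<alpha>] by simp
  interpret b: prob_space \<beta> using prob_momentD[OF \<beta>] by simp
  interpret pair_prob_space \<alpha> \<beta> ..
  show ?thesis
    using integral_fst'[OF integrable_pair_norm_powr[OF assms]]
    by (simp add: mutual_energy_def potential_def[abs_def] split_def)
qed

text \<open>Schoenberg's representation integrated over pairs of points, with the order of integration exchanged
by Tonelli's theorem, as all integrands are nonnegative.\<close>

lemma mutual_energy_gaussian_mixture:
  fixes \<alpha> \<beta> :: "'a::euclidean_space measure"
  assumes \<alpha>: "\<alpha> \<in> prob_moment q" and \<beta>: "\<beta> \<in> prob_moment q" and "0 < q"
    and C: "0 \<le> C" "\<And>r. 0 \<le> r \<Longrightarrow>
      (\<integral>\<^sup>+s. ennreal (stable_weight q s * (1 - exp (- s * r\<^sup>2))) \<partial>lborel) = ennreal (C * r powr q)"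
  shows "has_bochner_integral lborel (\<lambda>s. stable_weight q s * (1 - gauss_energy s \<alpha> \<beta>))
    (C * mutual_energy q \<alpha> \<beta>)"
proof -
  note a = prob_momentD[OF \<alpha>] and b = prob_momentD[OF \<beta>]
  note [measurable_cong] = a(1) b(1)
  interpret a: prob_space \<alpha> by fact
  interpret b: prob_space \<beta> by fact
  interpret ab: pair_prob_space \<alpha> \<beta> ..
  interpret P: pair_sigma_finite "\<alpha> \<Otimes>\<^sub>M \<beta>" "lborel :: real measure" ..
  define h where "h s p = stable_weight q s * (1 - gauss s (fst p - snd p))" for s and p :: "'a \<times> 'a"
  have h0: "0 \<le> h s p" for s p
    by (cases "0 < s") (auto simp: h_def stable_weight_def)
  have [measurable]: "(\<lambda>(p, s). ennreal (h s p)) \<in> borel_measurable ((\<alpha> \<Otimes>\<^sub>M \<beta>) \<Otimes>\<^sub>M lborel)"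
    unfolding h_def gauss_def by measurable
  have "(\<lambda>s. gauss_energy s \<alpha> \<beta>) \<in> borel_measurable lborel"
    unfolding gauss_energy_def gauss_def by measurable
  then have m [measurable]: "(\<lambda>s. gauss_energy s \<alpha> \<beta>) \<in> borel_measurable borel"
    by simp
  have ih: "integrable (\<alpha> \<Otimes>\<^sub>M \<beta>) (h s)"
    and h_int: "(LINT p|(\<alpha> \<Otimes>\<^sub>M \<beta>). h s p) = stable_weight q s * (1 - gauss_energy s \<alpha> \<beta>)" for s
  proof -
    have "integrable (\<alpha> \<Otimes>\<^sub>M \<beta>) (h s) \<and>
      (LINT p|(\<alpha> \<Otimes>\<^sub>M \<beta>). h s p) = stable_weight q s * (1 - gauss_energy s \<alpha> \<beta>)"
    proof (cases "0 < s")
      case True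
      then have "integrable (\<alpha> \<Otimes>\<^sub>M \<beta>) (\<lambda>p. gauss s (fst p - snd p))"
        by (intro ab.integrable_const_bound[of _ 1]) auto
      then show ?thesis
        unfolding h_def[abs_def] by (auto simp: gauss_energy_def ab.prob_space)
    qed (simp add: h_def[abs_def] stable_weight_def)
    then show "integrable (\<alpha> \<Otimes>\<^sub>M \<beta>) (h s)"
      "(LINT p|(\<alpha> \<Otimes>\<^sub>M \<beta>). h s p) = stable_weight q s * (1 - gauss_energy s \<alpha> \<beta>)" by auto
  qed
  have nonneg: "0 \<le> stable_weight q s * (1 - gauss_energy s \<alpha> \<beta>)" for s
    unfolding h_int[symmetric] using h0 by (intro integral_nonneg_AE) auto
  have "(\<integral>\<^sup>+s. ennreal (stable_weight q s * (1 - gauss_energy s \<alpha> \<beta>)) \<partial>lborel) =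
    (\<integral>\<^sup>+s. (\<integral>\<^sup>+p. ennreal (h s p) \<partial>(\<alpha> \<Otimes>\<^sub>M \<beta>)) \<partial>lborel)"
    by (intro nn_integral_cong) (simp add: nn_integral_eq_integral[OF ih] h0 h_int)
  also have "\<dots> = (\<integral>\<^sup>+p. (\<integral>\<^sup>+s. ennreal (h s p) \<partial>lborel) \<partial>(\<alpha> \<Otimes>\<^sub>M \<beta>))"
    by (rule P.Fubini') measurable
  also have "\<dots> = (\<integral>\<^sup>+p. ennreal (C * norm (fst p - snd p) powr q) \<partial>(\<alpha> \<Otimes>\<^sub>M \<beta>))"
    by (intro nn_integral_cong) (simp only: h_def gauss_def C(2)[OF norm_ge_zero])
  also have "\<dots> = ennreal (C * mutual_energy q \<alpha> \<beta>)"
    unfolding mutual_energy_eq_pair_integral[OF assms(1-3)]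
    using integrable_pair_norm_powr[OF assms(1-3)] C(1)
    by (subst nn_integral_eq_integral) (auto simp: split_def)
  finally have *: "(\<integral>\<^sup>+s. ennreal (stable_weight q s * (1 - gauss_energy s \<alpha> \<beta>)) \<partial>lborel) =
    ennreal (C * mutual_energy q \<alpha> \<beta>)" .
  show ?thesis
    by (rule has_bochner_integral_nn_integral[OF _ _ _ *])
       (use nonneg C(1) in \<open>auto simp: mutual_energy_def potential_def intro!: integral_nonneg_AE mult_nonneg_nonneg\<close>)
qed

text \<open>The constants \<open>1\<close> in the Gaussian mixture cancel, since \<open>\<rho>\<close> and \<open>\<mu>\<close> have the same mass.\<close>

lemma MMD2_gaussian_mixture:
  fixes \<rho> \<mu> :: "'a::euclidean_space measure"
  assumes \<rho>: "\<rho> \<in> prob_moment q" and \<mu>: "\<mu> \<in> prob_moment q" and q: "0 < q"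
    and C: "0 \<le> C" "\<And>r. 0 \<le> r \<Longrightarrow>
      (\<integral>\<^sup>+s. ennreal (stable_weight q s * (1 - exp (- s * r\<^sup>2))) \<partial>lborel) = ennreal (C * r powr q)"
  shows "has_bochner_integral lborel (\<lambda>s. stable_weight q s * gauss_discrepancy s \<rho> \<mu>)
    (2 * C * MMD2 q \<rho> \<mu>)"
proof -
  have "has_bochner_integral lborel (\<lambda>s. 2 * (stable_weight q s * (1 - gauss_energy s \<rho> \<mu>)) -
      stable_weight q s * (1 - gauss_energy s \<rho> \<rho>) - stable_weight q s * (1 - gauss_energy s \<mu> \<mu>))
    (2 * (C * mutual_energy q \<rho> \<mu>) - C * mutual_energy q \<rho> \<rho> - C * mutual_energy q \<mu> \<mu>)"
    by (intro has_bochner_integral_diff has_bochner_integral_mult_right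
        mutual_energy_gaussian_mixture \<rho> \<mu> q C)
  moreover have "2 * (stable_weight q s * (1 - gauss_energy s \<rho> \<mu>)) -
      stable_weight q s * (1 - gauss_energy s \<rho> \<rho>) - stable_weight q s * (1 - gauss_energy s \<mu> \<mu>)
      = stable_weight q s * gauss_discrepancy s \<rho> \<mu>" for s
    by (simp add: gauss_discrepancy_def algebra_simps)
  moreover have "2 * (C * mutual_energy q \<rho> \<mu>) - C * mutual_energy q \<rho> \<rho> - C * mutual_energy q \<mu> \<mu> =
    2 * C * MMD2 q \<rho> \<mu>"
    by (simp add: MMD2_eq_mutual_energy[OF \<rho> \<mu> q] algebra_simps)
  ultimately show ?thesis by simp
qed

text \<open>All Gaussian discrepancies are nonnegative and the weight is at least its value at \<open>2 a\<close> on the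
interval \<open>[a, 2 a]\<close>, so a large Gaussian discrepancy at all scales of this interval would make the
mixture too large.\<close>

lemma exists_scale_discrepancy_le:
  assumes q: "0 < q" "q < 2" and a: "0 < a"
  obtains K where "0 \<le> K"
    "\<And>\<rho> \<mu> :: 'a::euclidean_space measure. \<rho> \<in> prob_moment q \<Longrightarrow> \<mu> \<in> prob_moment q \<Longrightarrow>
      \<exists>s\<in>{a..2 * a}. gauss_discrepancy s \<rho> \<mu> \<le> K * MMD2 q \<rho> \<mu>"
proof -
  obtain C where C: "0 \<le> C" "\<And>r. 0 \<le> r \<Longrightarrow>
      (\<integral>\<^sup>+s. ennreal (stable_weight q s * (1 - exp (- s * r\<^sup>2))) \<partial>lborel) = ennreal (C * r powr q)"
    using powr_gaussian_mixture[OF q] by blast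
  define W where "W = a * stable_weight q (2 * a)"
  have W: "W > 0" using a by (simp add: W_def stable_weight_def)
  have "\<exists>s\<in>{a..2 * a}. gauss_discrepancy s \<rho> \<mu> \<le> 2 * C / W * MMD2 q \<rho> \<mu>"
    if \<rho>: "\<rho> \<in> prob_moment q" and \<mu>: "\<mu> \<in> prob_moment q" for \<rho> \<mu> :: "'a measure"
  proof (rule ccontr)
    define k where "k = 2 * C / W * MMD2 q \<rho> \<mu>"
    assume "\<not> ?thesis"
    then have D: "k < gauss_discrepancy s \<rho> \<mu>" if "s \<in> {a..2 * a}" for s
      using that by (auto simp: k_def not_le)
    note I = MMD2_gaussian_mixture[OF \<rho> \<mu> q(1) C]
    have D0: "0 \<le> gauss_discrepancy s \<rho> \<mu>" if "0 < s" for s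
      using prob_momentD[OF \<rho>] prob_momentD[OF \<mu>] that by (intro gauss_discrepancy_nonneg) auto
    have sw: "stable_weight q (2 * a) \<le> stable_weight q s" if "s \<in> {a..2 * a}" for s
      using that a q by (auto simp: stable_weight_def intro!: powr_mono2')
    \<comment> \<open>Under the assumption this function is nonnegative with integral zero, yet positive on an interval.\<close>
    define f where "f s = stable_weight q s * gauss_discrepancy s \<rho> \<mu> -
       stable_weight q (2 * a) * k * indicator {a..2 * a} s" for s
    have bi: "has_bochner_integral lborel f (2 * C * MMD2 q \<rho> \<mu> - stable_weight q (2 * a) * k * measure lborel {a..2 * a})"
      unfolding f_def using a
      by (intro has_bochner_integral_diff I has_bochner_integral_mult_right has_bochner_integral_real_indicator) auto
    moreover have "stable_weight q (2 * a) * k * measure lborel {a..2 * a} = 2 * C * MMD2 q \<rho> \<mu>"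
    proof -
      have "stable_weight q (2 * a) * k * a = W * k" by (simp add: W_def)
      also have "\<dots> = 2 * C * MMD2 q \<rho> \<mu>" using W by (simp add: k_def)
      finally show ?thesis using a by simp
    qed
    ultimately have f: "integrable lborel f" "(LINT s|lborel. f s) = 0"
      by (simp_all add: has_bochner_integral_iff)
    have f_pos: "0 < f s" if s: "s \<in> {a..2 * a}" for s
    proof -
      have "stable_weight q (2 * a) * k < stable_weight q (2 * a) * gauss_discrepancy s \<rho> \<mu>"
        using D[OF s] a by (simp add: stable_weight_def)
      also have "\<dots> \<le> stable_weight q s * gauss_discrepancy s \<rho> \<mu>"
        using sw[OF s] D0[of s] s a by (intro mult_right_mono) auto
      finally show ?thesis using s by (simp add: f_def)
    qed
    have f_nn: "0 \<le> f s" for s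
    proof (cases "s \<in> {a..2 * a}")
      case False
      then show ?thesis using D0[of s] by (cases "0 < s") (auto simp: f_def stable_weight_def)
    qed (use f_pos in force)
    have "AE s in lborel. f s = 0"
      using integral_nonneg_eq_0_iff_AE[OF f(1)] f f_nn by simp
    then have "AE s in lborel. s \<notin> {a..2 * a}"
      by eventually_elim (use f_pos in force)
    then have "emeasure lborel {a..2 * a} = 0"
      by (subst (asm) AE_iff_measurable[of "{a..2 * a}"]) auto
    then show False using a by simp
  qed
  moreover have "0 \<le> 2 * C / W" using C W by simp
  ultimately show ?thesis using that by blast
qed

section \<open>Test functions with compact support\<close>

lemma exp_power_tendsto_0:
  fixes c :: real
  assumes "0 < c"
  shows "((\<lambda>s. exp (- c * s) * sqrt (2 * s) ^ d) \<longlongrightarrow> 0) at_top"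
proof -
  have "filterlim (\<lambda>s. c * s) at_top at_top"
    using assms by (intro filterlim_tendsto_pos_mult_at_top[OF tendsto_const _ filterlim_ident])
  from filterlim_compose[OF tendsto_power_div_exp_0[of d] this]
  have "((\<lambda>s. (2 / c) ^ d * ((c * s) ^ d / exp (c * s))) \<longlongrightarrow> (2 / c) ^ d * 0) at_top"
    by (intro tendsto_mult tendsto_const)
  then have lim: "((\<lambda>s. (2 / c) ^ d * ((c * s) ^ d / exp (c * s))) \<longlongrightarrow> 0) at_top" by simp
  show ?thesis
  proof (rule tendsto_sandwich[OF _ _ tendsto_const lim])
    show "\<forall>\<^sub>F s in at_top. 0 \<le> exp (- c * s) * sqrt (2 * s) ^ d"
      using eventually_ge_at_top[of 0] by eventually_elim simp
    show "\<forall>\<^sub>F s in at_top. exp (- c * s) * sqrt (2 * s) ^ d \<le> (2 / c) ^ d * ((c * s) ^ d / exp (c * s))"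
      using eventually_ge_at_top[of 1]
    proof eventually_elim
      case (elim s)
      have "sqrt (2 * s) \<le> 2 * s"
        using elim by (intro real_le_lsqrt) (auto simp: power2_eq_square)
      then have "sqrt (2 * s) ^ d \<le> (2 * s) ^ d" using elim by (intro power_mono) auto
      then have "exp (- c * s) * sqrt (2 * s) ^ d \<le> exp (- c * s) * (2 * s) ^ d"
        by (intro mult_left_mono) auto
      also have "(2 * s) ^ d = (2 / c) ^ d * (c * s) ^ d"
        unfolding power_mult_distrib[symmetric] using assms by simp
      finally show ?case by (simp add: exp_minus divide_inverse mult_ac)
    qed
  qed
qed

text \<open>The smoothing is a Gaussian average of \<open>g\<close>. Points closer than the modulus of continuity \<open>\<delta>\<close>
contribute at most \<open>\<epsilon> / 2\<close>, and the rest is a Gaussian tail. The rate \<open>2 s\<close> is split into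
\<open>2 (s - 1)\<close>, which makes the tail exponentially small, and \<open>2\<close>, which keeps it integrable. Since
the total Gaussian mass decays only polynomially in \<open>s\<close>, the normalized tail tends to zero.\<close>

lemma gaussian_smoothing_uniform:
  fixes g :: "'a::euclidean_space \<Rightarrow> real"
  assumes uc: "uniformly_continuous_on UNIV g" and M: "\<And>x. \<bar>g x\<bar> \<le> M" and eps: "0 < \<epsilon>"
  obtains a where "1 \<le> a"
    "\<And>s x. a \<le> s \<Longrightarrow> \<bar>g x - (LINT z|lborel. g z * gauss (2 * s) (z - x)) / gauss_integral TYPE('a) (2 * s)\<bar> \<le> \<epsilon>"
proof -
  let ?I = "gauss_integral TYPE('a)"
  define d where "d = DIM('a)"
  have [measurable]: "g \<in> borel_measurable borel"
    using uniformly_continuous_imp_continuous[OF uc] by (rule borel_measurable_continuous_onI)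
  have M0: "0 \<le> M" using M[of 0] by linarith
  obtain \<delta> where \<delta>: "0 < \<delta>" "\<And>x z. norm (z - x) < \<delta> \<Longrightarrow> \<bar>g x - g z\<bar> < \<epsilon> / 2"
    using uc eps unfolding uniformly_continuous_on_def
    by (metis UNIV_I abs_minus_commute dist_norm half_gt_zero real_norm_def)
  define tail where "tail s = 2 * M * exp (- 2 * (s - 1) * \<delta>\<^sup>2) * ?I 2 / ?I (2 * s)" for s
  define V where "V = unit_ball_vol (real d)"
  have V: "V > 0" by (simp add: V_def)
  define B where "B = 2 * M * exp (2 * \<delta>\<^sup>2) * ?I 2 * exp 1 / V"
  have "((\<lambda>s. B * (exp (- (2 * \<delta>\<^sup>2) * s) * sqrt (2 * s) ^ d)) \<longlongrightarrow> B * 0) at_top"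
    using \<delta>(1) by (intro tendsto_mult tendsto_const exp_power_tendsto_0) auto
  then have ev: "\<forall>\<^sub>F s in at_top. B * (exp (- (2 * \<delta>\<^sup>2) * s) * sqrt (2 * s) ^ d) < \<epsilon> / 2"
    using eps by (intro order_tendstoD(2)) auto
  have tail_le: "tail s \<le> B * (exp (- (2 * \<delta>\<^sup>2) * s) * sqrt (2 * s) ^ d)" if s: "1 \<le> s" for s
  proof -
    have "exp (- 1) * (V * (1 / sqrt (2 * s)) ^ d) \<le> ?I (2 * s)"
      using gauss_integral_ge[of "2 * s", where 'a = 'a] s by (simp add: content_ball V_def d_def)
    moreover have p: "0 < exp (- 1) * (V * (1 / sqrt (2 * s)) ^ d)" using V s by simp
    ultimately have "tail s \<le> 2 * M * exp (- 2 * (s - 1) * \<delta>\<^sup>2) * ?I 2 / (exp (- 1) * (V * (1 / sqrt (2 * s)) ^ d))"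
      unfolding tail_def using M0 gauss_integral_pos[of 2, where 'a = 'a] by (intro divide_left_mono) auto
    also have "\<dots> = 2 * M * ?I 2 * (exp (- 2 * (s - 1) * \<delta>\<^sup>2) * exp 1) * sqrt (2 * s) ^ d / V"
      using s V by (simp add: exp_minus power_one_over field_simps)
    also have "exp (- 2 * (s - 1) * \<delta>\<^sup>2) = exp (2 * \<delta>\<^sup>2) * exp (- (2 * \<delta>\<^sup>2) * s)"
      unfolding exp_add[symmetric] by (simp add: algebra_simps)
    finally show ?thesis by (simp add: B_def mult_ac)
  qed
  have "\<forall>\<^sub>F s in at_top. tail s \<le> \<epsilon> / 2"
    using ev eventually_ge_at_top[of 1]
  proof eventually_elim
    case (elim s)
    then show ?case using tail_le[of s] by linarith
  qed
  then obtain a0 where a0: "\<And>s. a0 \<le> s \<Longrightarrow> tail s \<le> \<epsilon> / 2"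
    by (auto simp: eventually_at_top_linorder)
  show ?thesis
  proof (rule that[of "max 1 a0"])
    fix s and x :: 'a assume "max 1 a0 \<le> s"
    then have s: "1 \<le> s" and t: "tail s \<le> \<epsilon> / 2" using a0 by auto
    note G = integrable_gauss[of "2 * s" x] and G2 = integrable_gauss[of 2 x]
    have Ip: "0 < ?I (2 * s)" using s by (intro gauss_integral_pos) auto
    have ig: "integrable lborel (\<lambda>z. g z * gauss (2 * s) (z - x))"
    proof (rule Bochner_Integration.integrable_bound)
      show "integrable lborel (\<lambda>z. M * gauss (2 * s) (z - x))" using G s by simp
      show "AE z in lborel. norm (g z * gauss (2 * s) (z - x)) \<le> norm (M * gauss (2 * s) (z - x))"
        using M M0 by (auto simp: abs_mult intro!: mult_right_mono)
    qed measurable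
    have pt: "\<bar>(g x - g z) * gauss (2 * s) (z - x)\<bar> \<le>
        \<epsilon> / 2 * gauss (2 * s) (z - x) + 2 * M * exp (- 2 * (s - 1) * \<delta>\<^sup>2) * gauss 2 (z - x)" for z
    proof (cases "norm (z - x) < \<delta>")
      case True
      have "\<bar>(g x - g z) * gauss (2 * s) (z - x)\<bar> \<le> \<epsilon> / 2 * gauss (2 * s) (z - x)"
        using mult_right_mono[OF less_imp_le[OF \<delta>(2)[OF True]] gauss_nonneg[of "2 * s" "z - x"]]
        by (simp add: abs_mult)
      then show ?thesis using M0 by (simp add: add_increasing2)
    next
      case False
      then have "\<delta>\<^sup>2 \<le> (norm (z - x))\<^sup>2" using \<delta>(1) by (intro power_mono) auto
      then have "2 * (s - 1) * \<delta>\<^sup>2 \<le> 2 * (s - 1) * (norm (z - x))\<^sup>2" using s by (intro mult_left_mono) auto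
      then have "gauss (2 * s) (z - x) \<le> exp (- 2 * (s - 1) * \<delta>\<^sup>2) * gauss 2 (z - x)"
        unfolding gauss_def exp_add[symmetric] by (simp add: algebra_simps)
      moreover have "\<bar>g x - g z\<bar> \<le> 2 * M" using M[of x] M[of z] by linarith
      ultimately have "\<bar>(g x - g z) * gauss (2 * s) (z - x)\<bar> \<le>
          (2 * M) * (exp (- 2 * (s - 1) * \<delta>\<^sup>2) * gauss 2 (z - x))"
        unfolding abs_mult by (intro mult_mono) auto
      then show ?thesis using eps by (simp add: add_increasing mult.assoc)
    qed
    have e1: "g x * ?I (2 * s) - (LINT z|lborel. g z * gauss (2 * s) (z - x)) =
      (LINT z|lborel. (g x - g z) * gauss (2 * s) (z - x))"
      using G ig s by (simp add: left_diff_distrib)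
    have "\<bar>g x * ?I (2 * s) - (LINT z|lborel. g z * gauss (2 * s) (z - x))\<bar> \<le>
      (LINT z|lborel. \<epsilon> / 2 * gauss (2 * s) (z - x) + 2 * M * exp (- 2 * (s - 1) * \<delta>\<^sup>2) * gauss 2 (z - x))"
      unfolding e1 using G G2 ig s pt
      by (intro integral_abs_bound[THEN order_trans] integral_mono) (auto simp: left_diff_distrib)
    also have "\<dots> = \<epsilon> / 2 * ?I (2 * s) + tail s * ?I (2 * s)"
      using G G2 s Ip by (simp add: tail_def)
    also have "\<dots> \<le> \<epsilon> / 2 * ?I (2 * s) + \<epsilon> / 2 * ?I (2 * s)"
      using t Ip by (intro add_left_mono mult_right_mono) auto
    also have "\<dots> = \<epsilon> * ?I (2 * s)" by simp
    finally have "\<bar>g x * ?I (2 * s) - (LINT z|lborel. g z * gauss (2 * s) (z - x))\<bar> / ?I (2 * s) \<le> \<epsilon>"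
      using Ip by (simp add: divide_le_eq)
    moreover have "g x - (LINT z|lborel. g z * gauss (2 * s) (z - x)) / ?I (2 * s) =
      (g x * ?I (2 * s) - (LINT z|lborel. g z * gauss (2 * s) (z - x))) / ?I (2 * s)"
      using Ip by (simp add: diff_divide_distrib)
    ultimately show "\<bar>g x - (LINT z|lborel. g z * gauss (2 * s) (z - x)) / ?I (2 * s)\<bar> \<le> \<epsilon>"
      using Ip by (simp only: abs_divide)
  qed simp
qed

text \<open>The Gaussian smoothing is moved from the test function to the measure by Fubini's theorem.\<close>

lemma integral_smoothed_function:
  fixes g :: "'a::euclidean_space \<Rightarrow> real"
  assumes [measurable_cong]: "sets \<rho> = sets borel" and "prob_space \<rho>"
    and g: "integrable lborel g" and s: "0 < s"
  shows "integrable \<rho> (\<lambda>x. LINT z|lborel. g z * gauss (2 * s) (z - x))"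
    and "integrable lborel (\<lambda>z. g z * gauss_smooth s \<rho> z)"
    and "(LINT x|\<rho>. LINT z|lborel. g z * gauss (2 * s) (z - x)) = (LINT z|lborel. g z * gauss_smooth s \<rho> z)"
proof -
  interpret prob_space \<rho> by fact
  interpret P: pair_sigma_finite \<rho> "lborel :: 'a measure" ..
  have [measurable]: "g \<in> borel_measurable borel" using g by auto
  have "integrable (\<rho> \<Otimes>\<^sub>M lborel) (\<lambda>(x, z). g z)"
    using g by (intro P.Fubini_integrable) auto
  then have i: "integrable (\<rho> \<Otimes>\<^sub>M lborel) (\<lambda>(x, z). g z * gauss (2 * s) (z - x))"
    by (rule Bochner_Integration.integrable_bound)
       (use s in \<open>auto simp: abs_mult intro!: AE_I2 mult_left_le\<close>)
  have *: "(LINT x|\<rho>. gauss (2 * s) (z - x)) = gauss_smooth s \<rho> z" for z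
    by (simp add: gauss_smooth_def gauss_minus_commute[of _ z])
  show "integrable \<rho> (\<lambda>x. LINT z|lborel. g z * gauss (2 * s) (z - x))"
    using P.integrable_fst'[OF i] by simp
  show "integrable lborel (\<lambda>z. g z * gauss_smooth s \<rho> z)"
    using P.integrable_snd[OF i] by (simp add: *)
  show "(LINT x|\<rho>. LINT z|lborel. g z * gauss (2 * s) (z - x)) = (LINT z|lborel. g z * gauss_smooth s \<rho> z)"
    using P.Fubini_integral[OF i] by (simp add: *)
qed

text \<open>The test function is replaced by its Gaussian smoothing at a scale \<open>s \<in> [a, 2 a]\<close> with a small
Gaussian discrepancy; \<open>a\<close> is so large that this changes the integrals by little. The integral of
the smoothed function against \<open>\<rho> - \<mu>\<close> is an \<open>L\<^sup>2\<close> pairing of \<open>g\<close> with the smoothing of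
\<open>\<rho> - \<mu>\<close>, to which Cauchy--Schwarz applies. That \<open>s\<close> stays in a compact interval makes \<open>K\<close>
independent of the measures.\<close>

lemma test_function_bound:
  fixes g :: "'a::euclidean_space \<Rightarrow> real"
  assumes q: "0 < q" "q < 2" and cont: "continuous_on UNIV g"
    and supp: "\<And>x. R < norm x \<Longrightarrow> g x = 0" and eps: "0 < \<epsilon>"
  obtains K where "0 \<le> K"
    "\<And>\<rho> \<mu>. \<rho> \<in> prob_moment q \<Longrightarrow> \<mu> \<in> prob_moment q \<Longrightarrow>
      ((LINT x|\<rho>. g x) - (LINT x|\<mu>. g x))\<^sup>2 \<le> \<epsilon> + K * MMD2 q \<rho> \<mu>"
proof -
  let ?I = "gauss_integral TYPE('a)"
  have [measurable]: "g \<in> borel_measurable borel"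
    using cont by (rule borel_measurable_continuous_onI)
  have "bounded (g ` cball 0 R)"
    using cont by (intro compact_imp_bounded compact_continuous_image) (auto intro: continuous_on_subset)
  then obtain M where M0: "0 < M" and "\<forall>y\<in>g ` cball 0 R. norm y \<le> M"
    unfolding bounded_pos by blast
  then have M': "\<And>x. x \<in> cball 0 R \<Longrightarrow> \<bar>g x\<bar> \<le> M" by simp
  have M: "\<bar>g x\<bar> \<le> M" for x
    using M'[of x] supp[of x] M0 by (cases "R < norm x") auto
  have uc: "uniformly_continuous_on UNIV g"
    unfolding uniformly_continuous_on_def
  proof (intro allI impI)
    fix e :: real assume e: "0 < e"
    have "uniformly_continuous_on (cball 0 (R + 1)) g"
      using cont by (intro compact_uniformly_continuous) (auto intro: continuous_on_subset)
    then obtain d where d: "0 < d" "\<And>x y. x \<in> cball 0 (R + 1) \<Longrightarrow> y \<in> cball 0 (R + 1) \<Longrightarrow>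
        dist y x < d \<Longrightarrow> dist (g y) (g x) < e"
      using e unfolding uniformly_continuous_on_def by metis
    have "dist (g y) (g x) < e" if "dist y x < min d 1" for x y
    proof (cases "x \<in> cball 0 (R + 1) \<and> y \<in> cball 0 (R + 1)")
      case True
      then show ?thesis using d that by auto
    next
      case False
      moreover have "norm x \<le> norm y + dist y x" "norm y \<le> norm x + dist y x"
        using norm_triangle_sub[of x y] norm_triangle_sub[of y x] by (auto simp: dist_norm norm_minus_commute)
      ultimately have "R < norm x" "R < norm y" using that by auto
      then show ?thesis using supp e by simp
    qed
    then show "\<exists>d>0. \<forall>x\<in>UNIV. \<forall>y\<in>UNIV. dist y x < d \<longrightarrow> dist (g y) (g x) < e"
      using d(1) by (intro exI[of _ "min d 1"]) auto
  qed
  \<comment> \<open>Each of the two measures costs \<open>\<eta>\<close>, and \<open>(2 \<eta> + u)\<^sup>2 \<le> 8 \<eta>\<^sup>2 + 2 u\<^sup>2\<close>.\<close>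
  define \<eta> where "\<eta> = sqrt (\<epsilon> / 8)"
  have \<eta>: "0 < \<eta>" "8 * \<eta>\<^sup>2 = \<epsilon>" using eps by (auto simp: \<eta>_def)
  obtain a where a: "1 \<le> a"
    "\<And>s x. a \<le> s \<Longrightarrow> \<bar>g x - (LINT z|lborel. g z * gauss (2 * s) (z - x)) / ?I (2 * s)\<bar> \<le> \<eta>"
    using gaussian_smoothing_uniform[OF uc M \<eta>(1)] by blast
  obtain K where K: "0 \<le> K"
    "\<And>\<rho> \<mu> :: 'a measure. \<rho> \<in> prob_moment q \<Longrightarrow> \<mu> \<in> prob_moment q \<Longrightarrow>
      \<exists>s\<in>{a..2 * a}. gauss_discrepancy s \<rho> \<mu> \<le> K * MMD2 q \<rho> \<mu>"
    using exists_scale_discrepancy_le[OF q, of a, where 'a = 'a] a by auto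
  have ind: "integrable lborel (\<lambda>z::'a. c * indicator (cball 0 R) z)" for c :: real
    by (intro integrable_mult_right integrable_real_indicator emeasure_lborel_cball_finite) auto
  have g1: "integrable lborel g"
    by (rule Bochner_Integration.integrable_bound[OF ind[of M]])
       (use M supp in \<open>auto split: split_indicator simp: not_le intro!: AE_I2 order_trans[OF M abs_ge_self]\<close>)
  have g2: "integrable lborel (\<lambda>z. (g z)\<^sup>2)"
    by (rule Bochner_Integration.integrable_bound[OF ind[of "M\<^sup>2"]])
       (use supp M M0 in \<open>auto split: split_indicator simp: not_le abs_le_square_iff[symmetric] intro!: AE_I2\<close>)
  define L where "L = (LINT z|lborel. (g z)\<^sup>2)"
  have L: "0 \<le> L" by (simp add: L_def)
  define H where "H = 2 * L / ?I (4 * a) * K"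
  have I4a: "0 < ?I (4 * a)" using a by (intro gauss_integral_pos) auto
  show ?thesis
  proof (rule that[of H])
    show "0 \<le> H" using L K I4a by (simp add: H_def)
    fix \<rho> \<mu> :: "'a measure"
    assume \<rho>: "\<rho> \<in> prob_moment q" and \<mu>: "\<mu> \<in> prob_moment q"
    note r = prob_momentD[OF \<rho>] and m = prob_momentD[OF \<mu>]
    note [measurable_cong] = r(1) m(1)
    obtain s where s: "a \<le> s" "s \<le> 2 * a" and D: "gauss_discrepancy s \<rho> \<mu> \<le> K * MMD2 q \<rho> \<mu>"
      using K(2)[OF \<rho> \<mu>] by auto
    have s0: "0 < s" using s a by simp
    define sm where "sm x = (LINT z|lborel. g z * gauss (2 * s) (z - x))" for x
    define D' where "D' = gauss_discrepancy s \<rho> \<mu>"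
    have Ip: "0 < ?I (2 * s)" using s0 by (intro gauss_integral_pos) auto
    note S\<rho> = integral_smoothed_function[OF r(1,2) g1 s0] and S\<mu> = integral_smoothed_function[OF m(1,2) g1 s0]
    have close: "\<bar>(LINT x|\<nu>. g x) - (LINT x|\<nu>. sm x) / ?I (2 * s)\<bar> \<le> \<eta>"
      if "prob_space \<nu>" "sets \<nu> = sets borel" "integrable \<nu> sm" for \<nu>
    proof -
      note [measurable_cong] = that(2)
      interpret prob_space \<nu> by fact
      have ig: "integrable \<nu> g" using M by (intro integrable_const_bound[of _ M]) auto
      have "(LINT x|\<nu>. g x) - (LINT x|\<nu>. sm x) / ?I (2 * s) = (LINT x|\<nu>. g x - sm x / ?I (2 * s))"
        using ig that by simp
      also have "\<bar>\<dots>\<bar> \<le> (LINT x|\<nu>. \<eta>)"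
        using ig that a(2)[OF s(1)]
        by (intro integral_abs_bound[THEN order_trans] integral_mono) (auto simp: sm_def[abs_def])
      finally show ?thesis by (simp add: prob_space)
    qed
    define A where "A = (LINT x|\<rho>. sm x) - (LINT x|\<mu>. sm x)"
    have A_eq: "A = (LINT z|lborel. g z * (gauss_smooth s \<rho> z - gauss_smooth s \<mu> z))"
      using S\<rho> S\<mu> by (simp add: A_def sm_def right_diff_distrib)
    have "A\<^sup>2 \<le> L * (?I (4 * s) * D')"
      unfolding A_eq L_def D'_def smooth_difference_L2(2)[OF r(1) m(1) r(2) m(2) s0, symmetric]
      using g2 smooth_difference_L2(1)[OF r(1) m(1) r(2) m(2) s0] S\<rho>(2) S\<mu>(2)
      by (intro integral_Cauchy_Schwarz) (auto simp: right_diff_distrib)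
    have D'0: "0 \<le> D'"
      unfolding D'_def using r m s0 by (intro gauss_discrepancy_nonneg) auto
    have I1: "?I (4 * s) \<le> ?I (2 * s)" and I2: "?I (4 * a) \<le> ?I (2 * s)"
      using s s0 by (auto intro!: gauss_integral_antimono)
    have "(A / ?I (2 * s))\<^sup>2 \<le> L * D' / ?I (4 * a)"
    proof -
      have "A\<^sup>2 \<le> L * (?I (2 * s) * D')"
        using \<open>A\<^sup>2 \<le> L * (?I (4 * s) * D')\<close> I1 L D'0
        by (meson mult_left_mono mult_right_mono order_trans)
      then have "(A / ?I (2 * s))\<^sup>2 \<le> L * (?I (2 * s) * D') / (?I (2 * s))\<^sup>2"
        using Ip by (simp add: power_divide divide_right_mono)
      also have "\<dots> = L * D' / ?I (2 * s)" using Ip by (simp add: power2_eq_square)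
      also have "\<dots> \<le> L * D' / ?I (4 * a)"
        using I2 I4a L D'0 Ip by (intro divide_left_mono) auto
      finally show ?thesis .
    qed
    also have "\<dots> \<le> L * (K * MMD2 q \<rho> \<mu>) / ?I (4 * a)"
      using D L I4a by (intro divide_right_mono mult_left_mono) (auto simp: D'_def)
    finally have A2: "2 * (A / ?I (2 * s))\<^sup>2 \<le> H * MMD2 q \<rho> \<mu>"
      by (simp add: H_def)
    define h where "h = (LINT x|\<rho>. g x) - (LINT x|\<mu>. g x)"
    have "\<bar>h\<bar> \<le> 2 * \<eta> + \<bar>A / ?I (2 * s)\<bar>"
      using close[OF r(2,1)] close[OF m(2,1)] S\<rho>(1) S\<mu>(1)
      by (simp add: h_def A_def sm_def[abs_def] diff_divide_distrib)
    then have "h\<^sup>2 \<le> (2 * \<eta> + \<bar>A / ?I (2 * s)\<bar>)\<^sup>2"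
      using \<eta>(1) by (simp add: abs_le_square_iff[symmetric])
    also have "\<dots> \<le> 2 * (2 * \<eta>)\<^sup>2 + 2 * (\<bar>A / ?I (2 * s)\<bar>)\<^sup>2"
      using sum_squares_bound[of "2 * \<eta>" "\<bar>A / ?I (2 * s)\<bar>"] by (simp add: power2_sum)
    also have "\<dots> = \<epsilon> + 2 * (A / ?I (2 * s))\<^sup>2"
      unfolding power2_abs using \<eta>(2) by (simp add: power_mult_distrib)
    finally show "((LINT x|\<rho>. g x) - (LINT x|\<mu>. g x))\<^sup>2 \<le> \<epsilon> + H * MMD2 q \<rho> \<mu>"
      using A2 by (simp add: h_def)
  qed
qed

section \<open>Narrow convergence\<close>

lemma test_functions_converge:
  fixes g :: "'a::euclidean_space \<Rightarrow> real"
  assumes q: "0 < q" "q < 2" and \<mu>: "\<mu> \<in> prob_moment q"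
    and \<rho>: "\<forall>\<^sub>F n in sequentially. \<rho> n \<in> prob_moment q \<and> MMD2 q (\<rho> n) \<mu> \<le> e n"
    and e: "e \<longlonglongrightarrow> 0"
    and g: "continuous_on UNIV g" "\<And>x. R < norm x \<Longrightarrow> g x = 0"
  shows "(\<lambda>n. LINT x|\<rho> n. g x) \<longlonglongrightarrow> (LINT x|\<mu>. g x)"
proof (rule tendstoI)
  fix r :: real assume r: "0 < r"
  obtain K where K: "0 \<le> K"
    "\<And>\<rho> \<mu>. \<rho> \<in> prob_moment q \<Longrightarrow> \<mu> \<in> prob_moment q \<Longrightarrow>
      ((LINT x|\<rho>. g x) - (LINT x|\<mu>. g x))\<^sup>2 \<le> r\<^sup>2 / 2 + K * MMD2 q \<rho> \<mu>"
    using test_function_bound[OF q g(1), of R "r\<^sup>2 / 2"] g(2) r by auto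
  have "(\<lambda>n. K * e n) \<longlonglongrightarrow> K * 0" using e by (intro tendsto_mult tendsto_const)
  then have "\<forall>\<^sub>F n in sequentially. K * e n < r\<^sup>2 / 2"
    using r by (intro order_tendstoD(2)) auto
  with \<rho> show "\<forall>\<^sub>F n in sequentially. dist (LINT x|\<rho> n. g x) (LINT x|\<mu>. g x) < r"
  proof eventually_elim
    case (elim n)
    have "K * MMD2 q (\<rho> n) \<mu> \<le> K * e n" using elim K(1) by (intro mult_left_mono) auto
    then have "((LINT x|\<rho> n. g x) - (LINT x|\<mu>. g x))\<^sup>2 < r\<^sup>2"
      using K(2)[of "\<rho> n" \<mu>] elim \<mu> by auto
    then show ?case
      using power2_less_imp_less[of "\<bar>(LINT x|\<rho> n. g x) - (LINT x|\<mu>. g x)\<bar>" r] r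
      by (simp add: dist_real_def)
  qed
qed

definition cutoff :: "real \<Rightarrow> 'a::euclidean_space \<Rightarrow> real" where
  "cutoff R x = max 0 (min 1 (R + 1 - norm x))"

lemma cutoff_bounds: "0 \<le> cutoff R x" "cutoff R x \<le> 1" "\<bar>cutoff R x\<bar> \<le> 1"
  by (auto simp: cutoff_def)

lemma cutoff_support: "R + 1 < norm x \<Longrightarrow> cutoff R x = 0"
  by (simp add: cutoff_def)

lemma continuous_on_cutoff: "continuous_on S (cutoff R)"
  unfolding cutoff_def[abs_def] by (intro continuous_intros)

lemma integral_cutoff_tendsto_1:
  fixes \<mu> :: "'a::euclidean_space measure"
  assumes [measurable_cong]: "sets \<mu> = sets borel" and "prob_space \<mu>"
  shows "(\<lambda>n. LINT x|\<mu>. cutoff (real n) x) \<longlonglongrightarrow> 1"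
proof -
  interpret prob_space \<mu> by fact
  have [measurable]: "cutoff R \<in> borel_measurable borel" for R :: real
    by (rule borel_measurable_continuous_onI[OF continuous_on_cutoff])
  have "(\<lambda>n. LINT x|\<mu>. cutoff (real n) x) \<longlonglongrightarrow> (LINT x|\<mu>. 1)"
  proof (rule integral_dominated_convergence[where w = "\<lambda>_. 1"])
    have "(\<lambda>n. cutoff (real n) x) \<longlonglongrightarrow> 1" for x :: 'a
    proof (rule tendsto_eventually)
      obtain n0 where n0: "norm x \<le> real n0" using real_arch_simple by blast
      show "\<forall>\<^sub>F n in sequentially. cutoff (real n) x = 1"
        using eventually_ge_at_top[of n0] by eventually_elim (use n0 in \<open>simp add: cutoff_def\<close>)
    qed
    then show "AE x in \<mu>. (\<lambda>n. cutoff (real n) x) \<longlonglongrightarrow> 1" by simp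
    show "AE x in \<mu>. norm (cutoff (real n) x) \<le> 1" for n
      by (simp add: cutoff_bounds)
  qed auto
  then show ?thesis by (simp add: prob_space)
qed

lemma integral_truncation_error:
  fixes f :: "'a::euclidean_space \<Rightarrow> real"
  assumes [measurable_cong]: "sets \<nu> = sets borel" and "prob_space \<nu>"
    and [measurable]: "f \<in> borel_measurable borel" and M: "\<And>x. \<bar>f x\<bar> \<le> M"
  shows "\<bar>(LINT x|\<nu>. f x) - (LINT x|\<nu>. f x * cutoff R x)\<bar> \<le> M * (1 - (LINT x|\<nu>. cutoff R x))"
proof -
  interpret prob_space \<nu> by fact
  have [measurable]: "cutoff R \<in> borel_measurable borel"
    by (rule borel_measurable_continuous_onI[OF continuous_on_cutoff])
  have M0: "0 \<le> M" using M[of 0] by linarith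
  have i1: "integrable \<nu> f" using M by (intro integrable_const_bound[of _ M]) auto
  have i2: "integrable \<nu> (cutoff R)"
    by (intro integrable_const_bound[of _ 1]) (auto simp: cutoff_bounds)
  have "\<bar>f x * cutoff R x\<bar> \<le> M * 1" for x
    unfolding abs_mult using M[of x] cutoff_bounds[of R x] M0 by (intro mult_mono) auto
  then have i3: "integrable \<nu> (\<lambda>x. f x * cutoff R x)"
    by (intro integrable_const_bound[of _ M]) auto
  have pt: "\<bar>f x - f x * cutoff R x\<bar> \<le> M * (1 - cutoff R x)" for x
  proof -
    have "f x - f x * cutoff R x = f x * (1 - cutoff R x)" by (simp add: algebra_simps)
    then have "\<bar>f x - f x * cutoff R x\<bar> = \<bar>f x\<bar> * (1 - cutoff R x)"
      using cutoff_bounds[of R x] by (simp add: abs_mult)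
    then show ?thesis using M[of x] cutoff_bounds[of R x] by (simp add: mult_right_mono)
  qed
  have "(LINT x|\<nu>. f x) - (LINT x|\<nu>. f x * cutoff R x) = (LINT x|\<nu>. f x - f x * cutoff R x)"
    using i1 i3 by simp
  also have "\<bar>\<dots>\<bar> \<le> (LINT x|\<nu>. M * (1 - cutoff R x))"
    using i1 i2 i3 pt by (intro integral_abs_bound[THEN order_trans] integral_mono) auto
  also have "\<dots> = M * (1 - (LINT x|\<nu>. cutoff R x))"
    using i2 by (simp add: prob_space)
  finally show ?thesis .
qed

text \<open>A bounded continuous function is truncated to compact support. The truncation error for \<open>\<mu>\<close> is
small because \<open>\<mu>\<close> has total mass one; the error for \<open>\<rho> n\<close> follows, because the cutoff is itself an
admissible test function: no mass escapes to infinity.\<close>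

lemma narrowly_converges_if_MMD2_tendsto_0:
  fixes \<mu> :: "'a::euclidean_space measure"
  assumes q: "0 < q" "q < 2" and \<mu>: "\<mu> \<in> prob_moment q"
    and \<rho>: "\<forall>\<^sub>F n in sequentially. \<rho> n \<in> prob_moment q \<and> MMD2 q (\<rho> n) \<mu> \<le> e n"
    and e: "e \<longlonglongrightarrow> 0"
  shows "narrowly_converges \<rho> \<mu>"
  unfolding narrowly_converges_def
proof (intro allI impI, elim conjE, rule tendstoI)
  fix f :: "'a \<Rightarrow> real" and r :: real
  assume cont: "continuous_on UNIV f" and "bounded (range f)" and r: "0 < r"
  then obtain M where M: "0 < M" "\<And>x. \<bar>f x\<bar> \<le> M"
    by (auto simp: bounded_pos)
  have fm: "f \<in> borel_measurable borel" using cont by (rule borel_measurable_continuous_onI)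
  note m = prob_momentD[OF \<mu>]
  note conv = test_functions_converge[OF q \<mu> \<rho> e]
  \<comment> \<open>The two truncation errors cost \<open>M * \<eta> = r / 4\<close> each, which leaves \<open>r / 2\<close> for the truncated function.\<close>
  define \<eta> where "\<eta> = r / (4 * M)"
  have \<eta>: "0 < \<eta>" "M * \<eta> = r / 4" using r M by (auto simp: \<eta>_def)
  have "\<forall>\<^sub>F n in sequentially. 1 - \<eta> < (LINT x|\<mu>. cutoff (real n) x)"
    using integral_cutoff_tendsto_1[OF m(1,2)] \<eta> by (intro order_tendstoD(1)) auto
  then obtain n0 where n0: "1 - \<eta> < (LINT x|\<mu>. cutoff (real n0) x)"
    by (auto simp: eventually_sequentially)
  define R where "R = real n0"
  have "\<forall>\<^sub>F n in sequentially. 1 - \<eta> < (LINT x|\<rho> n. cutoff R x)"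
  proof (rule order_tendstoD(1))
    show "(\<lambda>n. LINT x|\<rho> n. cutoff R x) \<longlonglongrightarrow> (LINT x|\<mu>. cutoff R x)"
      by (rule conv[OF continuous_on_cutoff cutoff_support])
  qed (use n0 in \<open>simp add: R_def\<close>)
  moreover have "(\<lambda>n. LINT x|\<rho> n. f x * cutoff R x) \<longlonglongrightarrow> (LINT x|\<mu>. f x * cutoff R x)"
    by (rule conv[of _ "R + 1"]) (auto intro!: continuous_on_mult cont continuous_on_cutoff simp: cutoff_support)
  then have "\<forall>\<^sub>F n in sequentially.
      dist (LINT x|\<rho> n. f x * cutoff R x) (LINT x|\<mu>. f x * cutoff R x) < r / 2"
    using r by (intro tendstoD) auto
  ultimately show "\<forall>\<^sub>F n in sequentially. dist (LINT x|\<rho> n. f x) (LINT x|\<mu>. f x) < r"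
    using \<rho>
  proof eventually_elim
    case (elim n)
    then have s: "sets (\<rho> n) = sets borel" "prob_space (\<rho> n)" using prob_momentD by blast+
    have "M * (1 - (LINT x|\<mu>. cutoff R x)) \<le> M * \<eta>" "M * (1 - (LINT x|\<rho> n. cutoff R x)) \<le> M * \<eta>"
      using n0 elim M(1) by (auto simp: R_def)
    then show ?case
      using integral_truncation_error[OF s fm M(2), of R]
        integral_truncation_error[OF m(1,2) fm M(2), of R] elim(2) \<eta>(2)
      unfolding dist_real_def by linarith
  qed
qed

section \<open>Convergence of the particle system\<close>

text \<open>At time zero the discrepancy equals the initial energy, and it does not increase, so the supremum is
attained at the initial time.\<close>

theorem corollary4p9:
  fixes q :: real and p :: ereal
    and \<mu> :: "'a::euclidean_space measure"
    and X :: "nat \<Rightarrow> nat \<Rightarrow> real \<Rightarrow> 'a"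
  assumes q: "0 < q" "q < 2"
    and cases_pq:
      "(real DIM('a) + q - 2 > 0 \<and> ereal (real DIM('a) / (real DIM('a) + q - 2)) < p) \<or>
       (DIM('a) = 1 \<and> q = 1 \<and> p = \<infinity>) \<or>
       (DIM('a) = 1 \<and> q < 1 \<and> ereal (1 / q) < p)"
    and \<mu>: "\<mu> \<in> prob_moment (max 1 q)" "measure_in_Lp p \<mu>"
    and init: "\<And>N. N \<ge> 2 \<Longrightarrow> inj_on (\<lambda>i. X N i 0) {1..N}"
    and sol: "\<And>N. N \<ge> 2 \<Longrightarrow> collision_free_solution q \<mu> N (X N)"
    and energy: "(\<lambda>N. particle_energy q \<mu> N (\<lambda>i. X N i 0)) \<longlonglongrightarrow> 0"
  shows "((\<lambda>N. SUP t\<in>{0..}. ereal (MMD2 q (empirical N (\<lambda>i. X N i t)) \<mu>)) \<longlonglongrightarrow> 0) \<and>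
    (\<forall>T :: nat \<Rightarrow> real. (\<forall>N\<ge>2. 0 \<le> T N) \<longrightarrow>
       narrowly_converges (\<lambda>N. empirical N (\<lambda>i. X N i (T N))) \<mu>)"
proof (intro conjI allI impI)
  define E where "E N = particle_energy q \<mu> N (\<lambda>i. X N i 0)" for N
  have \<mu>q: "\<mu> \<in> prob_moment q"
    using \<mu>(1) q(1) by (rule prob_moment_mono) simp
  have emp: "empirical N x \<in> prob_moment q" if "N \<ge> 2" for N and x :: "nat \<Rightarrow> 'a"
    using that by (intro empirical_prob_moment) auto
  have decay: "MMD2 q (empirical N (\<lambda>i. X N i t)) \<mu> \<le> E N" if N: "N \<ge> 2" and t: "0 \<le> t" for N t
    unfolding E_def particle_energy_eq_MMD2[OF emp[OF N] \<mu>q q(1)]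
    by (rule MMD2_antimono[OF q \<mu>q integrable_singular_kernel[OF q cases_pq \<mu>]
          AE_neq_measure_in_Lp[OF \<mu>(2)] _ sol[OF N] t]) (use N in simp)
  have SUP_eq: "(SUP t\<in>{0..}. ereal (MMD2 q (empirical N (\<lambda>i. X N i t)) \<mu>)) = ereal (E N)"
    if N: "N \<ge> 2" for N
  proof (rule antisym)
    show "(SUP t\<in>{0..}. ereal (MMD2 q (empirical N (\<lambda>i. X N i t)) \<mu>)) \<le> ereal (E N)"
      using decay[OF N] by (intro SUP_least) simp
    show "ereal (E N) \<le> (SUP t\<in>{0..}. ereal (MMD2 q (empirical N (\<lambda>i. X N i t)) \<mu>))"
      unfolding E_def particle_energy_eq_MMD2[OF emp[OF N] \<mu>q q(1)]
      by (rule SUP_upper[of 0 "{0..}"]) simp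
  qed
  have lim: "E \<longlonglongrightarrow> 0" using energy by (simp add: E_def[abs_def])
  then have "(\<lambda>N. ereal (E N)) \<longlonglongrightarrow> 0" by (simp add: zero_ereal_def)
  moreover have "\<forall>\<^sub>F N in sequentially. ereal (E N) =
      (SUP t\<in>{0..}. ereal (MMD2 q (empirical N (\<lambda>i. X N i t)) \<mu>))"
    using eventually_ge_at_top[of 2] by eventually_elim (simp add: SUP_eq)
  ultimately show "(\<lambda>N. SUP t\<in>{0..}. ereal (MMD2 q (empirical N (\<lambda>i. X N i t)) \<mu>)) \<longlonglongrightarrow> 0"
    by (rule Lim_transform_eventually)
  fix T :: "nat \<Rightarrow> real" assume T: "\<forall>N\<ge>2. 0 \<le> T N"
  have "\<forall>\<^sub>F N in sequentially. empirical N (\<lambda>i. X N i (T N)) \<in> prob_moment q \<and>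
      MMD2 q (empirical N (\<lambda>i. X N i (T N))) \<mu> \<le> E N"
    using eventually_ge_at_top[of 2] by eventually_elim (use T decay emp in auto)
  then show "narrowly_converges (\<lambda>N. empirical N (\<lambda>i. X N i (T N))) \<mu>"
    by (rule narrowly_converges_if_MMD2_tendsto_0[OF q \<mu>q _ lim])
qed

end
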